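(* Let $W^{(1)},W^{(2)},\ldots$ be an infinite sequence of finite Coxeter groups such that $W^{(n)}$ has rank $n$. Let $X^{(n)}$ be the number of $W^{(n)}$-descents of a uniformly random element of $W^{(n)}$, with variance $s_n^2$. Then $X^{(n)}$ satisfies the CLT if and only if $s_n\to\infty$ as $n\to\infty$.
   Context: For a finite Coxeter group with root system having simple roots $\Delta$ and negative roots $\Phi^-$, the number of descents of $w$ is $\#\{\beta\in\Delta : w(\beta)\in\Phi^-\}$. A sequence of random variables $X^{(n)}$ satisfies the CLT if $(X^{(n)}-\mathbb{E}X^{(n)})/\sqrt{\mathbb{V}X^{(n)}}$ converges in distribution to $N(0,1)$. *)

theory Defs
  imports "HOL-Probability.Probability"
begin

text \<open>Vectors of R^d are represented as functions nat => real vanishing at all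
  coordinates >= d; d is the ambient dimension (it may vary along a sequence).\<close>

definition vspace :: "nat \<Rightarrow> (nat \<Rightarrow> real) set" where
  "vspace d = {v. \<forall>i\<ge>d. v i = 0}"

definition ip :: "nat \<Rightarrow> (nat \<Rightarrow> real) \<Rightarrow> (nat \<Rightarrow> real) \<Rightarrow> real" where
  "ip d u v = (\<Sum>i<d. u i * v i)"

definition refl :: "nat \<Rightarrow> (nat \<Rightarrow> real) \<Rightarrow> (nat \<Rightarrow> real) \<Rightarrow> (nat \<Rightarrow> real)" where
  "refl d \<alpha> = (\<lambda>v i. v i - (2 * ip d v \<alpha> / ip d \<alpha> \<alpha>) * \<alpha> i)"

definition root_system :: "nat \<Rightarrow> (nat \<Rightarrow> real) set \<Rightarrow> bool" where
  "root_system d \<Phi> \<longleftrightarrow> finite \<Phi> \<and> \<Phi> \<subseteq> vspace d \<and> (\<lambda>_. 0) \<notin> \<Phi> \<and>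
     (\<forall>\<alpha>\<in>\<Phi>. \<forall>c::real. (\<lambda>i. c * \<alpha> i) \<in> \<Phi> \<longleftrightarrow> c = 1 \<or> c = -1) \<and>
     (\<forall>\<alpha>\<in>\<Phi>. refl d \<alpha> ` \<Phi> = \<Phi>)"

definition lin_comb :: "(nat \<Rightarrow> real) set \<Rightarrow> ((nat \<Rightarrow> real) \<Rightarrow> real) \<Rightarrow> (nat \<Rightarrow> real)" where
  "lin_comb \<Delta> c = (\<lambda>i. \<Sum>\<beta>\<in>\<Delta>. c \<beta> * \<beta> i)"

definition lin_indep :: "(nat \<Rightarrow> real) set \<Rightarrow> bool" where
  "lin_indep \<Delta> \<longleftrightarrow> finite \<Delta> \<and> (\<forall>c. lin_comb \<Delta> c = (\<lambda>_. 0) \<longrightarrow> (\<forall>\<beta>\<in>\<Delta>. c \<beta> = 0))"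

definition simple_system :: "(nat \<Rightarrow> real) set \<Rightarrow> (nat \<Rightarrow> real) set \<Rightarrow> bool" where
  "simple_system \<Phi> \<Delta> \<longleftrightarrow> \<Delta> \<subseteq> \<Phi> \<and> lin_indep \<Delta> \<and>
     (\<forall>\<alpha>\<in>\<Phi>. \<exists>c. \<alpha> = lin_comb \<Delta> c \<and> ((\<forall>\<beta>\<in>\<Delta>. c \<beta> \<ge> 0) \<or> (\<forall>\<beta>\<in>\<Delta>. c \<beta> \<le> 0)))"

definition neg_roots :: "(nat \<Rightarrow> real) set \<Rightarrow> (nat \<Rightarrow> real) set \<Rightarrow> (nat \<Rightarrow> real) set" where
  "neg_roots \<Phi> \<Delta> = {\<alpha>\<in>\<Phi>. \<exists>c. \<alpha> = lin_comb \<Delta> c \<and> (\<forall>\<beta>\<in>\<Delta>. c \<beta> \<le> 0)}"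

inductive_set coxeter_group :: "nat \<Rightarrow> (nat \<Rightarrow> real) set \<Rightarrow> ((nat \<Rightarrow> real) \<Rightarrow> (nat \<Rightarrow> real)) set"
  for d \<Phi> where
  id: "id \<in> coxeter_group d \<Phi>"
| step: "\<alpha> \<in> \<Phi> \<Longrightarrow> w \<in> coxeter_group d \<Phi> \<Longrightarrow> refl d \<alpha> \<circ> w \<in> coxeter_group d \<Phi>"

definition num_descents ::
  "(nat \<Rightarrow> real) set \<Rightarrow> (nat \<Rightarrow> real) set \<Rightarrow> ((nat \<Rightarrow> real) \<Rightarrow> (nat \<Rightarrow> real)) \<Rightarrow> nat" where
  "num_descents \<Phi> \<Delta> w = card {\<beta>\<in>\<Delta>. w \<beta> \<in> neg_roots \<Phi> \<Delta>}"

definition satisfies_CLT :: "(nat \<Rightarrow> 'a pmf) \<Rightarrow> (nat \<Rightarrow> 'a \<Rightarrow> real) \<Rightarrow> bool" where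
  "satisfies_CLT p X \<longleftrightarrow>
     weak_conv_m
       (\<lambda>n. distr (measure_pmf (p n)) borel
          (\<lambda>x. (X n x - measure_pmf.expectation (p n) (X n))
                 / sqrt (measure_pmf.variance (p n) (X n))))
       std_normal_distribution"

end

theory Submission
  imports Defs
begin

text \<open>
  Averaging over the cosets of a parabolic subgroup, each of which contains an element that is
  positive on the given simple roots, shows that descents in mutually orthogonal sets of simple
  roots are independent.  Hence the descent indicators have the Coxeter diagram as dependency
  graph, and its degrees are bounded by positive semidefiniteness of the Gram matrix.  A
  differential inequality for the characteristic function (Stein--Tikhomirov) gives the CLT when the
  sum of the individual variances is \<open>O(s\<^sup>2)\<close>.  This bound can fail only because of isolated
  dihedral factors, where the two indicators nearly cancel; there they are merged into one
  variable with values in \<open>{- 1, 0, 1}\<close>.  On the rest of the diagram the edge labels are at most 6,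
  and the Gram matrix evaluated at the all-ones vector bounds the negative covariances.
  Conversely, integer-valued variables with bounded variance along a subsequence live on lattices
  of mesh bounded below, which excludes a continuous limit.\<close>

section \<open>A character estimate for sums over dependency graphs\<close>

text \<open>For a fixed argument the error in the differential inequality is of order
  \<open>(\<Sum>i\<in>I. v i) / s^3\<close>, hence the need to bound the summed second moments by a
  multiple of the total variance. An edge with label \<open>m\<close> has covariance at least
  \<open>1 / (2 * m) - 1 / 4\<close>, and as \<open>m\<close> grows this approaches
  \<open>- 1 / 4\<close>, the negative of a single variance. For \<open>m \<le> 6\<close> the
  possible loss is at most \<open>cos (pi / m) / 5\<close>. The Gram matrix bounds the sum of the
  cosines over ordered pairs by the number of vertices, so on average a vertex keeps
  \<open>1 / 4 - 1 / 5 = 1 / 20\<close>, one fifth of its variance. For \<open>m \<ge> 7\<close> the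
  square of \<open>cos (pi / m)\<close> exceeds \<open>3 / 4\<close>. The squared cosines at a
  vertex sum to at most 1 and each neighbour contributes at least \<open>1 / 4\<close>, so neither
  end of such an edge has room for a further neighbour: the edge is a whole component.\<close>

lemma norm_iexp_diff: "cmod (iexp a - iexp b) \<le> \<bar>a - b\<bar>"
proof -
  have "iexp a - iexp b = iexp b * (iexp (a - b) - 1)"
    by (simp add: exp_diff right_diff_distrib diff_divide_distrib of_real_diff)
  then have "cmod (iexp a - iexp b) = cmod (iexp (a - b) - 1)" by (simp add: norm_mult)
  also have "\<dots> \<le> \<bar>a - b\<bar>" using iexp_approx1[of "a - b" 0] by simp
  finally show ?thesis .
qed

lemma norm_iexp_taylor: "cmod (iexp a - 1 - \<i> * a) \<le> a\<^sup>2 / 2"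
  using iexp_approx1[of a 1] by (simp add: power2_eq_square algebra_simps)

text \<open>Over the support this is measurability with respect to the \<open>Y i\<close>,
  \<open>i \<in> A\<close>. Complex values are needed because the functions of interest are
  exponentials.\<close>

definition determined_on :: "'a pmf \<Rightarrow> ('i \<Rightarrow> 'a \<Rightarrow> real) \<Rightarrow> 'i set \<Rightarrow> ('a \<Rightarrow> complex) \<Rightarrow> bool" where
  "determined_on p Y A f \<longleftrightarrow>
     (\<forall>x\<in>set_pmf p. \<forall>y\<in>set_pmf p. (\<forall>i\<in>A. Y i x = Y i y) \<longrightarrow> f x = f y)"

lemma determined_onI:
  assumes "\<And>x y. x \<in> set_pmf p \<Longrightarrow> y \<in> set_pmf p \<Longrightarrow> (\<And>i. i \<in> A \<Longrightarrow> Y i x = Y i y) \<Longrightarrow> f x = f y"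
  shows "determined_on p Y A f"
  unfolding determined_on_def using assms by blast

lemma determined_on_sums:
  "determined_on p Y A (\<lambda>x. h (\<Sum>i\<in>A. Y i x / s))"
  by (rule determined_onI) (simp cong: sum.cong)

text \<open>\<open>N i\<close> is a closed neighbourhood, so \<open>D\<close> is one more than a
  degree bound. The separate parameter \<open>v i\<close> dominates all absolute mixed moments at
  \<open>i\<close>; the final error involves only the sum of the \<open>v i\<close>, which can be
  compared with the variance.\<close>

locale dependency_graph =
  fixes p :: "'a pmf" and I :: "'i set" and N :: "'i \<Rightarrow> 'i set" and D :: nat
    and Y :: "'i \<Rightarrow> 'a \<Rightarrow> real" and v :: "'i \<Rightarrow> real"
  assumes finite_p: "finite (set_pmf p)"
    and finite_I: "finite I"
    and N_sub: "i \<in> I \<Longrightarrow> N i \<subseteq> I"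
    and N_self: "i \<in> I \<Longrightarrow> i \<in> N i"
    and N_sym: "i \<in> I \<Longrightarrow> j \<in> N i \<Longrightarrow> i \<in> N j"
    and card_N: "i \<in> I \<Longrightarrow> card (N i) \<le> D"
    and bounded: "i \<in> I \<Longrightarrow> x \<in> set_pmf p \<Longrightarrow> \<bar>Y i x\<bar> \<le> 1"
    and centered: "i \<in> I \<Longrightarrow> measure_pmf.expectation p (Y i) = 0"
    and second: "i \<in> I \<Longrightarrow> j \<in> N i \<Longrightarrow> measure_pmf.expectation p (\<lambda>x. \<bar>Y i x * Y j x\<bar>) \<le> v i"
    and indep: "A \<subseteq> I \<Longrightarrow> B \<subseteq> I \<Longrightarrow> (\<And>a b. a \<in> A \<Longrightarrow> b \<in> B \<Longrightarrow> b \<notin> N a) \<Longrightarrow>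
      determined_on p Y A f \<Longrightarrow> determined_on p Y B g \<Longrightarrow>
      measure_pmf.expectation p (\<lambda>x. f x * g x)
        = measure_pmf.expectation p f * measure_pmf.expectation p g"
begin

abbreviation E :: "('a \<Rightarrow> 'b::{banach, second_countable_topology}) \<Rightarrow> 'b" where
  "E f \<equiv> measure_pmf.expectation p f"

lemma integrable_p [simp]: "integrable (measure_pmf p) f"
  for f :: "'a \<Rightarrow> 'b::{banach, second_countable_topology}"
  by (rule integrable_measure_pmf_finite[OF finite_p])

lemma E_cong: "(\<And>x. x \<in> set_pmf p \<Longrightarrow> f x = g x) \<Longrightarrow> E f = E g"
  for f :: "'a \<Rightarrow> 'b::{banach, second_countable_topology}"
  by (rule Bochner_Integration.integral_cong_AE) (auto simp: AE_measure_pmf_iff)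

lemma E_mono: "(\<And>x. x \<in> set_pmf p \<Longrightarrow> f x \<le> g x) \<Longrightarrow> E f \<le> E g"
  for f :: "'a \<Rightarrow> real"
  by (rule integral_mono_AE) (auto simp: AE_measure_pmf_iff)

lemma norm_E_le: "(\<And>x. x \<in> set_pmf p \<Longrightarrow> norm (f x) \<le> g x) \<Longrightarrow> norm (E f) \<le> E g"
  for f :: "'a \<Rightarrow> 'b::{banach, second_countable_topology}"
  by (rule order_trans[OF integral_norm_bound]) (rule E_mono)

lemma norm_E_le_const: "(\<And>x. x \<in> set_pmf p \<Longrightarrow> norm (f x) \<le> c) \<Longrightarrow> norm (E f) \<le> c"
  for f :: "'a \<Rightarrow> 'b::{banach, second_countable_topology}"
  using norm_E_le[of f "\<lambda>_. c"] by simp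

lemma E_uncorrelated:
  assumes "i \<in> I" "j \<in> I" "j \<notin> N i"
  shows "E (\<lambda>x. Y i x * Y j x) = 0"
proof -
  have "E (\<lambda>x. complex_of_real (Y i x) * complex_of_real (Y j x))
      = E (\<lambda>x. complex_of_real (Y i x)) * E (\<lambda>x. complex_of_real (Y j x))"
    by (rule indep[of "{i}" "{j}"]) (use assms in \<open>auto intro!: determined_onI\<close>)
  then have "complex_of_real (E (\<lambda>x. Y i x * Y j x)) = complex_of_real (E (Y i) * E (Y j))"
    by (simp flip: of_real_mult)
  then show ?thesis using centered[OF assms(1)] by simp
qed

text \<open>Non-neighbours are uncorrelated. The local covariances that appear vertex by vertex
  below therefore add up to the full variance.\<close>

lemma second_moment_sum:
  "E (\<lambda>x. (\<Sum>i\<in>I. Y i x)\<^sup>2) = (\<Sum>i\<in>I. \<Sum>j\<in>N i. E (\<lambda>x. Y i x * Y j x))"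
proof -
  have "E (\<lambda>x. (\<Sum>i\<in>I. Y i x)\<^sup>2) = (\<Sum>i\<in>I. \<Sum>j\<in>I. E (\<lambda>x. Y i x * Y j x))"
    by (simp add: power2_eq_square sum_product)
  also have "\<dots> = (\<Sum>i\<in>I. \<Sum>j\<in>N i. E (\<lambda>x. Y i x * Y j x))"
    using finite_I N_sub E_uncorrelated
    by (intro sum.cong HOL.refl sum.mono_neutral_right) auto
  finally show ?thesis .
qed

context
  fixes s :: real
  assumes s: "s > 0"
begin

definition Z :: "'i set \<Rightarrow> 'a \<Rightarrow> real" where "Z B x = (\<Sum>i\<in>B. Y i x / s)"

definition \<phi> :: "real \<Rightarrow> complex" where "\<phi> u = E (\<lambda>x. iexp (u * Z I x))"

lemma Z_bound:
  assumes "B \<subseteq> I" "x \<in> set_pmf p"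
  shows "\<bar>Z B x\<bar> \<le> card B / s"
proof -
  have "\<bar>Z B x\<bar> \<le> (\<Sum>i\<in>B. \<bar>Y i x / s\<bar>)" unfolding Z_def by (rule sum_abs)
  also have "\<dots> \<le> (\<Sum>i\<in>B. 1 / s)"
    using assms bounded s by (intro sum_mono) (auto simp: divide_right_mono)
  finally show ?thesis by simp
qed

lemma Z_diff: "A \<subseteq> B \<Longrightarrow> B \<subseteq> I \<Longrightarrow> Z (B - A) x = Z B x - Z A x"
  unfolding Z_def using finite_I by (intro sum_diff) (auto intro: finite_subset)

lemma determined_on_iexp: "determined_on p Y B (\<lambda>x. iexp (u * Z B x))"
  unfolding Z_def using determined_on_sums[of p Y B "\<lambda>r. iexp (u * r)" s] by simp

lemma norm_iexp_Z_diff: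
  assumes "A \<subseteq> B" "B \<subseteq> I" "card (B - A) \<le> k" "x \<in> set_pmf p"
  shows "cmod (iexp (u * Z A x) - iexp (u * Z B x)) \<le> \<bar>u\<bar> * k / s"
proof -
  have "cmod (iexp (u * Z A x) - iexp (u * Z B x)) \<le> \<bar>u * Z A x - u * Z B x\<bar>"
    by (rule norm_iexp_diff)
  also have "\<dots> = \<bar>u\<bar> * \<bar>Z (B - A) x\<bar>"
    unfolding Z_diff[OF assms(1,2)] by (simp add: abs_mult[symmetric] right_diff_distrib abs_minus_commute)
  also have "\<dots> \<le> \<bar>u\<bar> * (k / s)"
  proof (rule mult_left_mono)
    have "\<bar>Z (B - A) x\<bar> \<le> card (B - A) / s" using assms by (intro Z_bound) auto
    also have "\<dots> \<le> k / s" using assms(3) s by (simp add: divide_right_mono)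
    finally show "\<bar>Z (B - A) x\<bar> \<le> k / s" .
  qed simp
  finally show ?thesis by simp
qed

text \<open>Dropping the neighbours of \<open>i\<close> and \<open>j\<close> from the exponent makes it independent of
  \<open>Y i * Y j\<close>.\<close>

lemma pair_estimate:
  fixes u :: real
  assumes i: "i \<in> I" and j: "j \<in> N i"
  shows "cmod (E (\<lambda>x. of_real (Y i x * Y j x) * iexp (u * Z (I - N i) x))
      - of_real (E (\<lambda>x. Y i x * Y j x)) * \<phi> u) \<le> 3 * D * \<bar>u\<bar> * v i / s"
proof -
  define c where "c = E (\<lambda>x. \<bar>Y i x * Y j x\<bar>)"
  define B where "B = I - (N i \<union> N j)"
  let ?P = "\<lambda>x. complex_of_real (Y i x * Y j x)"
  have jI: "j \<in> I" using i j N_sub by blast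
  have fin: "finite (N i)" "finite (N j)" using i jI N_sub finite_I finite_subset by metis+
  have cc: "card (N i \<union> N j) \<le> 2 * D" "card (N j - N i) \<le> D"
    using card_N[OF i] card_N[OF jI] card_Un_le[of "N i" "N j"] card_mono[OF fin(2), of "N j - N i"]
    by auto
  have B1: "I - N i - B = N j - N i" "I - B = N i \<union> N j"
    using i jI N_sub unfolding B_def by blast+
  \<comment> \<open>Passing from \<open>I - N i\<close> to \<open>B\<close> discards only
    \<open>N j - N i\<close>, at most \<open>D\<close> summands.\<close>
  have e1: "cmod (E (\<lambda>x. ?P x * iexp (u * Z (I - N i) x)) - E (\<lambda>x. ?P x * iexp (u * Z B x)))
      \<le> c * (\<bar>u\<bar> * D / s)"
  proof -
    have "cmod (E (\<lambda>x. ?P x * iexp (u * Z B x) - ?P x * iexp (u * Z (I - N i) x)))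
      \<le> E (\<lambda>x. \<bar>Y i x * Y j x\<bar> * (\<bar>u\<bar> * D / s))"
    proof (rule norm_E_le)
      fix x assume x: "x \<in> set_pmf p"
      have "cmod (iexp (u * Z B x) - iexp (u * Z (I - N i) x)) \<le> \<bar>u\<bar> * D / s"
        by (rule norm_iexp_Z_diff) (use x cc B1 in \<open>auto simp: B_def\<close>)
      then have "cmod (?P x) * cmod (iexp (u * Z B x) - iexp (u * Z (I - N i) x))
          \<le> cmod (?P x) * (\<bar>u\<bar> * D / s)"
        by (rule mult_left_mono) (rule norm_ge_zero)
      then show "cmod (?P x * iexp (u * Z B x) - ?P x * iexp (u * Z (I - N i) x))
          \<le> \<bar>Y i x * Y j x\<bar> * (\<bar>u\<bar> * D / s)"
        unfolding right_diff_distrib[symmetric] norm_mult norm_of_real .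
    qed
    also have "\<dots> = c * (\<bar>u\<bar> * D / s)" unfolding c_def by simp
    finally show ?thesis by (simp add: norm_minus_commute)
  qed
  have "E (\<lambda>x. ?P x * iexp (u * Z B x)) = E ?P * E (\<lambda>x. iexp (u * Z B x))"
  proof (rule indep[of "{i, j}" B])
    show "b \<notin> N a" if "a \<in> {i, j}" "b \<in> B" for a b using that by (auto simp: B_def)
    show "determined_on p Y {i, j} ?P" by (rule determined_onI) simp
    show "determined_on p Y B (\<lambda>x. iexp (u * Z B x))" by (rule determined_on_iexp)
  qed (use i jI in \<open>auto simp: B_def\<close>)
  also have "E ?P = of_real (E (\<lambda>x. Y i x * Y j x))" by (rule integral_complex_of_real)
  finally have e2: "E (\<lambda>x. ?P x * iexp (u * Z B x))
      = of_real (E (\<lambda>x. Y i x * Y j x)) * E (\<lambda>x. iexp (u * Z B x))" .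
  \<comment> \<open>Going back from \<open>B\<close> to \<open>I\<close> restores at most
    \<open>2 * D\<close> summands; with \<open>e1\<close> this makes the factor 3.\<close>
  have e3: "cmod (of_real (E (\<lambda>x. Y i x * Y j x)) * E (\<lambda>x. iexp (u * Z B x))
      - of_real (E (\<lambda>x. Y i x * Y j x)) * \<phi> u) \<le> c * (\<bar>u\<bar> * real (2 * D) / s)"
    unfolding right_diff_distrib[symmetric] norm_mult
  proof (rule mult_mono)
    show "cmod (of_real (E (\<lambda>x. Y i x * Y j x))) \<le> c"
      unfolding c_def using norm_E_le[of "\<lambda>x. Y i x * Y j x"] by (simp add: abs_mult)
    have "cmod (E (\<lambda>x. iexp (u * Z B x) - iexp (u * Z I x))) \<le> \<bar>u\<bar> * real (2 * D) / s"
    proof (rule norm_E_le_const)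
      fix x assume "x \<in> set_pmf p"
      then show "cmod (iexp (u * Z B x) - iexp (u * Z I x)) \<le> \<bar>u\<bar> * real (2 * D) / s"
        by (intro norm_iexp_Z_diff) (use cc B1 in \<open>auto simp: B_def\<close>)
    qed
    then show "cmod (E (\<lambda>x. iexp (u * Z B x)) - \<phi> u) \<le> \<bar>u\<bar> * real (2 * D) / s"
      by (simp add: \<phi>_def)
    show "0 \<le> c" unfolding c_def by (rule integral_nonneg_AE) simp
  qed simp
  have "cmod (E (\<lambda>x. ?P x * iexp (u * Z (I - N i) x)) - of_real (E (\<lambda>x. Y i x * Y j x)) * \<phi> u)
     \<le> c * (\<bar>u\<bar> * D / s) + c * (\<bar>u\<bar> * real (2 * D) / s)"
    using norm_triangle_mono[OF e1 e3] unfolding e2 by simp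
  also have "\<dots> = c * (3 * D * \<bar>u\<bar> / s)" by (simp add: field_simps)
  also have "\<dots> \<le> v i * (3 * D * \<bar>u\<bar> / s)"
    using second[OF i j] s unfolding c_def by (intro mult_right_mono) auto
  finally show ?thesis by (simp add: mult_ac)
qed

text \<open>The exponential over \<open>N i\<close> is expanded to first order, with the part over
  \<open>I - N i\<close> kept as a factor. The constant term vanishes by independence and centring,
  the linear term is a sum of pairs, and the remainder is quadratic. The errors \<open>3\<close> and
  \<open>1 / 2\<close> are rounded up to 4.\<close>

lemma vertex_estimate:
  fixes u :: real
  assumes i: "i \<in> I"
  shows "cmod (E (\<lambda>x. of_real (Y i x) * iexp (u * Z I x))
      - \<i> * u * (of_real (\<Sum>j\<in>N i. E (\<lambda>x. Y i x * Y j x)) / s) * \<phi> u)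
      \<le> 4 * (real D)\<^sup>2 * u\<^sup>2 * v i / s\<^sup>2"
proof -
  have Ni: "N i \<subseteq> I" "finite (N i)" using N_sub[OF i] finite_I finite_subset by auto
  have v: "v i \<ge> 0"
    by (rule order_trans[OF _ second[OF i N_self[OF i]]]) (simp add: integral_nonneg_AE)
  let ?e = "\<lambda>x. iexp (u * Z (I - N i) x)"
  let ?R = "\<lambda>x. iexp (u * Z (N i) x) - 1 - \<i> * (u * Z (N i) x)"
  have split: "of_real (Y i x) * iexp (u * Z I x) =
      of_real (Y i x) * ?e x + (\<Sum>j\<in>N i. (\<i> * u / s) * (of_real (Y i x * Y j x) * ?e x))
      + of_real (Y i x) * ?R x * ?e x" for x
  proof -
    have "\<i> * complex_of_real (u * Z I x)
        = \<i> * complex_of_real (u * Z (N i) x) + \<i> * complex_of_real (u * Z (I - N i) x)"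
      unfolding Z_diff[OF Ni(1) order_refl] by (simp add: algebra_simps)
    then have e: "iexp (u * Z I x) = iexp (u * Z (N i) x) * ?e x" by (simp only: exp_add)
    have sum: "(\<Sum>j\<in>N i. (\<i> * u / s) * (of_real (Y i x * Y j x) * ?e x))
        = \<i> * (u * Z (N i) x) * of_real (Y i x) * ?e x"
      by (simp add: Z_def sum_distrib_left sum_distrib_right mult_ac)
    \<comment> \<open>Here \<open>w\<close> is the exponential over \<open>N i\<close>,
      \<open>r\<close> its linear Taylor term and \<open>z\<close> the remaining factor.\<close>
    have "y * (w * z) = y * z + r * y * z + y * (w - 1 - r) * z" for y w z r :: complex
      by (simp add: algebra_simps)
    then show ?thesis unfolding e sum .
  qed
  have E1: "E (\<lambda>x. of_real (Y i x) * ?e x) = 0"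
  proof -
    have "E (\<lambda>x. of_real (Y i x) * ?e x) = E (\<lambda>x. complex_of_real (Y i x)) * E ?e"
    proof (rule indep[of "{i}" "I - N i"])
      show "determined_on p Y {i} (\<lambda>x. of_real (Y i x))" by (rule determined_onI) simp
      show "determined_on p Y (I - N i) ?e" by (rule determined_on_iexp)
    qed (use i in auto)
    then show ?thesis using centered[OF i] by simp
  qed
  have E3: "cmod (E (\<lambda>x. of_real (Y i x) * ?R x * ?e x)) \<le> (real D)\<^sup>2 * u\<^sup>2 * v i / s\<^sup>2 / 2"
  proof -
    have "cmod (E (\<lambda>x. of_real (Y i x) * ?R x * ?e x))
        \<le> E (\<lambda>x. (\<Sum>j\<in>N i. \<bar>Y i x * Y j x\<bar>) * (u\<^sup>2 * D / s\<^sup>2 / 2))"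
    proof (rule norm_E_le)
      fix x assume x: "x \<in> set_pmf p"
      have z1: "\<bar>Z (N i) x\<bar> \<le> D / s"
      proof -
        have "\<bar>Z (N i) x\<bar> \<le> card (N i) / s" by (rule Z_bound[OF Ni(1) x])
        also have "\<dots> \<le> D / s" using card_N[OF i] s by (simp add: divide_right_mono)
        finally show ?thesis .
      qed
      \<comment> \<open>Only one of the two factors of the square gets the crude bound
        \<open>D / s\<close>. The other stays a sum, so that multiplication by \<open>Y i\<close>
        yields mixed moments controlled by \<open>v i\<close>.\<close>
      have z2: "\<bar>Z (N i) x\<bar> \<le> (\<Sum>j\<in>N i. \<bar>Y j x\<bar>) / s"
        unfolding Z_def sum_divide_distrib using s by (intro order_trans[OF sum_abs]) simp
      have "(Z (N i) x)\<^sup>2 = \<bar>Z (N i) x\<bar> * \<bar>Z (N i) x\<bar>" by (simp add: power2_eq_square)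
      also have "\<dots> \<le> (\<Sum>j\<in>N i. \<bar>Y j x\<bar>) / s * (D / s)"
        using z1 z2 s by (intro mult_mono) (auto intro!: sum_nonneg divide_nonneg_pos)
      finally have z: "(Z (N i) x)\<^sup>2 \<le> (\<Sum>j\<in>N i. \<bar>Y j x\<bar>) / s * (D / s)" .
      have "cmod (of_real (Y i x) * ?R x * ?e x) = \<bar>Y i x\<bar> * cmod (?R x)"
        by (simp add: norm_mult)
      also have "\<dots> \<le> \<bar>Y i x\<bar> * ((u * Z (N i) x)\<^sup>2 / 2)"
        using norm_iexp_taylor[of "u * Z (N i) x"] by (intro mult_left_mono) auto
      also have "\<dots> \<le> \<bar>Y i x\<bar> * (u\<^sup>2 * ((\<Sum>j\<in>N i. \<bar>Y j x\<bar>) / s * (D / s)) / 2)"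
        unfolding power_mult_distrib using z by (intro mult_left_mono divide_right_mono) auto
      also have "\<dots> = (\<Sum>j\<in>N i. \<bar>Y i x * Y j x\<bar>) * (u\<^sup>2 * D / s\<^sup>2 / 2)"
        unfolding abs_mult sum_distrib_left[symmetric] by (simp add: power2_eq_square)
      finally show "cmod (of_real (Y i x) * ?R x * ?e x)
          \<le> (\<Sum>j\<in>N i. \<bar>Y i x * Y j x\<bar>) * (u\<^sup>2 * D / s\<^sup>2 / 2)" .
    qed
    also have "\<dots> = (\<Sum>j\<in>N i. E (\<lambda>x. \<bar>Y i x * Y j x\<bar>)) * (u\<^sup>2 * D / s\<^sup>2 / 2)"
      by simp
    also have "\<dots> \<le> (\<Sum>j\<in>N i. v i) * (u\<^sup>2 * D / s\<^sup>2 / 2)"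
      using second[OF i] s by (intro mult_right_mono sum_mono) auto
    also have "\<dots> \<le> D * v i * (u\<^sup>2 * D / s\<^sup>2 / 2)"
      using card_N[OF i] s v by (intro mult_right_mono) (auto intro!: mult_right_mono)
    finally show ?thesis by (simp add: power2_eq_square mult_ac)
  qed
  have E2: "cmod (E (\<lambda>x. \<Sum>j\<in>N i. (\<i> * u / s) * (of_real (Y i x * Y j x) * ?e x))
      - \<i> * u * (of_real (\<Sum>j\<in>N i. E (\<lambda>x. Y i x * Y j x)) / s) * \<phi> u)
      \<le> 3 * (real D)\<^sup>2 * u\<^sup>2 * v i / s\<^sup>2"
  proof -
    have eq: "E (\<lambda>x. \<Sum>j\<in>N i. (\<i> * u / s) * (of_real (Y i x * Y j x) * ?e x))
      - \<i> * u * (of_real (\<Sum>j\<in>N i. E (\<lambda>x. Y i x * Y j x)) / s) * \<phi> u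
      = (\<Sum>j\<in>N i. (\<i> * u / s) * (E (\<lambda>x. of_real (Y i x * Y j x) * ?e x)
          - of_real (E (\<lambda>x. Y i x * Y j x)) * \<phi> u))"
      by (simp del: of_real_mult add: sum_subtractf right_diff_distrib sum_distrib_left
          sum_distrib_right sum_divide_distrib mult_ac)
    have "cmod (\<Sum>j\<in>N i. (\<i> * u / s) * (E (\<lambda>x. of_real (Y i x * Y j x) * ?e x)
          - of_real (E (\<lambda>x. Y i x * Y j x)) * \<phi> u))
        \<le> (\<Sum>j\<in>N i. (\<bar>u\<bar> / s) * (3 * D * \<bar>u\<bar> * v i / s))"
    proof (rule order_trans[OF norm_sum sum_mono])
      fix j assume j: "j \<in> N i"
      have "cmod (\<i> * u / s) = \<bar>u\<bar> / s" using s by (simp add: norm_mult norm_divide)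
      then show "cmod ((\<i> * u / s) * (E (\<lambda>x. of_real (Y i x * Y j x) * ?e x)
          - of_real (E (\<lambda>x. Y i x * Y j x)) * \<phi> u)) \<le> (\<bar>u\<bar> / s) * (3 * D * \<bar>u\<bar> * v i / s)"
        unfolding norm_mult[of "\<i> * u / s"] using s
        by (simp only:) (rule mult_left_mono[OF pair_estimate[OF i j]], simp)
    qed
    also have "\<dots> \<le> D * ((\<bar>u\<bar> / s) * (3 * D * \<bar>u\<bar> * v i / s))"
      unfolding sum_constant
    proof (rule mult_right_mono)
      show "real (card (N i)) \<le> real D" using card_N[OF i] by simp
      have "0 \<le> \<bar>u\<bar> / s" "0 \<le> real (3 * D) * \<bar>u\<bar> * v i / s" using v s by simp_all
      then show "0 \<le> (\<bar>u\<bar> / s) * (3 * D * \<bar>u\<bar> * v i / s)" by (rule mult_nonneg_nonneg)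
    qed
    also have "\<dots> = 3 * (real D)\<^sup>2 * u\<^sup>2 * v i / s\<^sup>2"
      unfolding power2_abs[of u, symmetric]
      by (simp add: power2_eq_square mult_ac del: abs_mult_self_eq power2_abs)
    finally show ?thesis unfolding eq .
  qed
  have "E (\<lambda>x. of_real (Y i x) * iexp (u * Z I x))
      = E (\<lambda>x. \<Sum>j\<in>N i. (\<i> * u / s) * (of_real (Y i x * Y j x) * ?e x))
        + E (\<lambda>x. of_real (Y i x) * ?R x * ?e x)"
    unfolding split
    by (simp only: Bochner_Integration.integral_add[OF integrable_p integrable_p] E1 add_0_left)
  then have "cmod (E (\<lambda>x. of_real (Y i x) * iexp (u * Z I x))
      - \<i> * u * (of_real (\<Sum>j\<in>N i. E (\<lambda>x. Y i x * Y j x)) / s) * \<phi> u)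
    \<le> 3 * (real D)\<^sup>2 * u\<^sup>2 * v i / s\<^sup>2 + (real D)\<^sup>2 * u\<^sup>2 * v i / s\<^sup>2 / 2"
    using norm_triangle_mono[OF E2 E3] by (simp only: add_diff_eq diff_add_eq)
  also have "\<dots> \<le> 4 * (real D)\<^sup>2 * u\<^sup>2 * v i / s\<^sup>2"
    using v s by (simp add: field_simps)
  finally show ?thesis .
qed

text \<open>The support is finite, so the expectation is a finite sum and can be differentiated
  termwise.\<close>

lemma char_deriv: "(\<phi> has_vector_derivative E (\<lambda>x. \<i> * Z I x * iexp (u * Z I x))) (at u within S)"
proof -
  have "\<phi> = (\<lambda>u. \<Sum>x\<in>set_pmf p. pmf p x *\<^sub>R iexp (u * Z I x))"
    unfolding \<phi>_def by (intro ext integral_measure_pmf finite_p)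
  moreover have "E (\<lambda>x. \<i> * Z I x * iexp (u * Z I x))
      = (\<Sum>x\<in>set_pmf p. pmf p x *\<^sub>R (\<i> * Z I x * iexp (u * Z I x)))"
    by (intro integral_measure_pmf finite_p)
  moreover have "((\<lambda>u. iexp (u * z)) has_vector_derivative \<i> * z * iexp (u * z)) (at u within S)" for z :: real
  proof -
    have "((\<lambda>w. exp (\<i> * (w * z))) has_field_derivative \<i> * z * iexp (u * z)) (at (of_real u))"
      by (auto intro!: derivative_eq_intros)
    then have "((\<lambda>w. exp (\<i> * (complex_of_real w * complex_of_real z))) has_vector_derivative \<i> * z * iexp (u * z)) (at u within S)"
      by (rule has_vector_derivative_real_field)
    then show ?thesis by simp
  qed
  ultimately show ?thesis
    by (auto intro!: derivative_eq_intros has_vector_derivative_sum)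
qed

text \<open>The normal characteristic function solves \<open>f' u = - u * f u\<close>. Summing the
  vertex estimates with weight \<open>\<i> / s\<close> gives this equation up to an error: the
  covariances add up to \<open>s * s\<close>, and \<open>\<i> * \<i>\<close> supplies the
  sign.\<close>

lemma char_ode:
  assumes var: "s\<^sup>2 = E (\<lambda>x. (\<Sum>i\<in>I. Y i x)\<^sup>2)" and K: "(\<Sum>i\<in>I. v i) \<le> K * s\<^sup>2"
  shows "cmod (E (\<lambda>x. \<i> * Z I x * iexp (u * Z I x)) + u * \<phi> u) \<le> 4 * (real D)\<^sup>2 * K * u\<^sup>2 / s"
proof -
  let ?a = "\<lambda>i. E (\<lambda>x. of_real (Y i x) * iexp (u * Z I x))"
  let ?b = "\<lambda>i. \<i> * u * (of_real (\<Sum>j\<in>N i. E (\<lambda>x. Y i x * Y j x)) / s) * \<phi> u"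
  have "E (\<lambda>x. \<i> * Z I x * iexp (u * Z I x)) = E (\<lambda>x. \<Sum>i\<in>I. (\<i> / s) * (of_real (Y i x) * iexp (u * Z I x)))"
    by (rule E_cong, subst (1) Z_def) (simp add: sum_distrib_left sum_distrib_right mult_ac)
  also have "\<dots> = (\<Sum>i\<in>I. (\<i> / s) * ?a i)" by simp
  finally have a: "E (\<lambda>x. \<i> * Z I x * iexp (u * Z I x)) = (\<Sum>i\<in>I. (\<i> / s) * ?a i)" .
  have V: "(\<Sum>i\<in>I. \<Sum>j\<in>N i. E (\<lambda>x. Y i x * Y j x)) = s * s"
    using second_moment_sum var by (simp add: power2_eq_square)
  have "(\<Sum>i\<in>I. (\<i> / s) * ?b i)
      = - (u * (of_real (\<Sum>i\<in>I. \<Sum>j\<in>N i. E (\<lambda>x. Y i x * Y j x)) / (s * s)) * \<phi> u)"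
    by (simp add: sum_distrib_left sum_distrib_right sum_divide_distrib sum_negf mult_ac)
  also have "\<dots> = - (u * \<phi> u)" unfolding V using s by simp
  finally have b: "(\<Sum>i\<in>I. (\<i> / s) * ?b i) = - (u * \<phi> u)" .
  have eq: "E (\<lambda>x. \<i> * Z I x * iexp (u * Z I x)) + u * \<phi> u = (\<Sum>i\<in>I. (\<i> / s) * (?a i - ?b i))"
    unfolding a right_diff_distrib[of "\<i> / s"] sum_subtractf b by simp
  have "cmod (\<Sum>i\<in>I. (\<i> / s) * (?a i - ?b i)) \<le> (\<Sum>i\<in>I. (1 / s) * (4 * (real D)\<^sup>2 * u\<^sup>2 * v i / s\<^sup>2))"
  proof (rule order_trans[OF norm_sum sum_mono])
    fix i assume i: "i \<in> I"
    have "cmod (\<i> / s) = 1 / s" using s by (simp add: norm_divide)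
    then show "cmod ((\<i> / s) * (?a i - ?b i)) \<le> (1 / s) * (4 * (real D)\<^sup>2 * u\<^sup>2 * v i / s\<^sup>2)"
      unfolding norm_mult[of "\<i> / s"] using s
      by (simp only:) (rule mult_left_mono[OF vertex_estimate[OF i]], simp)
  qed
  also have "\<dots> = 4 * (real D)\<^sup>2 * u\<^sup>2 / s^3 * (\<Sum>i\<in>I. v i)"
    unfolding sum_distrib_left by (simp add: power2_eq_square power3_eq_cube mult_ac)
  also have "\<dots> \<le> 4 * (real D)\<^sup>2 * u\<^sup>2 / s^3 * (K * s\<^sup>2)"
    using K s by (intro mult_left_mono) auto
  also have "\<dots> = 4 * (real D)\<^sup>2 * K * u\<^sup>2 / s"
    using s by (simp add: power2_eq_square power3_eq_cube)
  finally show ?thesis unfolding eq .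
qed

text \<open>With the integrating factor \<open>exp (u\<^sup>2 / 2)\<close> the function
  \<open>g\<close> would be constant in the exactly normal case. Its derivative is bounded by the
  error in \<open>char_ode\<close>, and multiplying back by \<open>exp (- t\<^sup>2 / 2)\<close>
  removes the exponential from the bound.\<close>

theorem char_normal_estimate:
  assumes var: "s\<^sup>2 = E (\<lambda>x. (\<Sum>i\<in>I. Y i x)\<^sup>2)" and K: "(\<Sum>i\<in>I. v i) \<le> K * s\<^sup>2" "K \<ge> 0"
  shows "cmod (E (\<lambda>x. iexp (t * ((\<Sum>i\<in>I. Y i x) / s))) - exp (- t\<^sup>2 / 2))
      \<le> 4 * (real D)\<^sup>2 * K * \<bar>t\<bar> ^ 3 / s"
proof -
  define g where "g u = exp (u\<^sup>2 / 2) *\<^sub>R \<phi> u" for u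
  define g' where "g' u = exp (u\<^sup>2 / 2) *\<^sub>R (E (\<lambda>x. \<i> * Z I x * iexp (u * Z I x)) + u * \<phi> u)" for u
  define C where "C = 4 * (real D)\<^sup>2 * K / s"
  have C: "C \<ge> 0" using K s by (simp add: C_def)
  have deriv: "(g has_vector_derivative g' u) (at u within S)" for u S
    unfolding g_def g'_def
    by (auto intro!: derivative_eq_intros char_deriv simp: scaleR_conv_of_real algebra_simps)
  have bound: "norm (g' u) \<le> exp (t\<^sup>2 / 2) * (C * t\<^sup>2)" if "u \<in> closed_segment 0 t" for u
  proof -
    have "\<bar>u\<bar> \<le> \<bar>t\<bar>" using that by (auto simp: closed_segment_eq_real_ivl split: if_splits)
    then have ut: "u\<^sup>2 \<le> t\<^sup>2" by (rule abs_le_square_iff[THEN iffD1])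
    have "norm (g' u) \<le> exp (u\<^sup>2 / 2) * (C * u\<^sup>2)"
      unfolding g'_def norm_scaleR abs_exp_cancel
    proof (rule mult_left_mono)
      show "cmod (E (\<lambda>x. \<i> * Z I x * iexp (u * Z I x)) + u * \<phi> u) \<le> C * u\<^sup>2"
        using char_ode[OF var K(1), of u] by (simp only: C_def times_divide_eq_left)
    qed simp
    also have "\<dots> \<le> exp (t\<^sup>2 / 2) * (C * t\<^sup>2)"
      using ut C by (intro mult_mono) auto
    finally show ?thesis .
  qed
  \<comment> \<open>Mean value inequality along the segment from 0 to \<open>t\<close>, which covers
    both signs of \<open>t\<close>; the length \<open>\<bar>t\<bar>\<close> raises the power to
    3.\<close>
  have "norm (g t - g 0) \<le> exp (t\<^sup>2 / 2) * (C * t\<^sup>2) * norm (t - 0)"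
  proof (rule differentiable_bound[where S = "closed_segment 0 t" and f' = "\<lambda>u h. h *\<^sub>R g' u"])
    show "(g has_derivative (\<lambda>h. h *\<^sub>R g' u)) (at u within closed_segment 0 t)" for u
      using deriv unfolding has_vector_derivative_def .
    show "onorm (\<lambda>h. h *\<^sub>R g' u) \<le> exp (t\<^sup>2 / 2) * (C * t\<^sup>2)" if "u \<in> closed_segment 0 t" for u
    proof (rule onorm_le)
      fix h :: real
      show "norm (h *\<^sub>R g' u) \<le> exp (t\<^sup>2 / 2) * (C * t\<^sup>2) * norm h"
        using mult_right_mono[OF bound[OF that], of "\<bar>h\<bar>"] by (simp add: mult.commute)
    qed
  qed auto
  moreover have "g 0 = 1" by (simp add: g_def \<phi>_def)
  ultimately have "cmod (g t - 1) \<le> exp (t\<^sup>2 / 2) * (C * t\<^sup>2) * \<bar>t\<bar>" by simp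
  then have "exp (- t\<^sup>2 / 2) * cmod (g t - 1) \<le> exp (- t\<^sup>2 / 2) * (exp (t\<^sup>2 / 2) * (C * t\<^sup>2) * \<bar>t\<bar>)"
    by (rule mult_left_mono) simp
  also have "\<dots> = (exp (- t\<^sup>2 / 2) * exp (t\<^sup>2 / 2)) * (C * \<bar>t\<bar> ^ 3)"
    by (simp add: power2_eq_square power3_eq_cube abs_mult[symmetric] mult_ac)
  also have "exp (- t\<^sup>2 / 2) * exp (t\<^sup>2 / 2) = 1" by (simp flip: exp_add)
  finally have "exp (- t\<^sup>2 / 2) * cmod (g t - 1) \<le> C * \<bar>t\<bar> ^ 3" by simp
  moreover have "\<phi> t - exp (- t\<^sup>2 / 2) = exp (- t\<^sup>2 / 2) *\<^sub>R (g t - 1)"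
    by (simp add: g_def scaleR_conv_of_real right_diff_distrib exp_minus)
  moreover have "\<phi> t = E (\<lambda>x. iexp (t * ((\<Sum>i\<in>I. Y i x) / s)))"
    by (simp add: \<phi>_def Z_def sum_divide_distrib)
  ultimately show ?thesis by (simp add: C_def mult_ac)
qed

end

end

section \<open>Convergence to the normal distribution\<close>

lemma std_normal_interval_pos:
  assumes "a < b"
  shows "cdf std_normal_distribution a < cdf std_normal_distribution b"
proof -
  interpret N: real_distribution std_normal_distribution by (rule real_dist_normal_dist)
  have "measure std_normal_distribution {a<..b} \<noteq> 0"
  proof
    assume "measure std_normal_distribution {a<..b} = 0"
    then have "emeasure std_normal_distribution {a<..b} = 0"
      by (simp add: N.emeasure_eq_measure)
    then have "{a<..b} \<in> null_sets (density lborel (\<lambda>x. ennreal (std_normal_density x)))"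
      by (auto simp: null_sets_def)
    then have "AE x in lborel. x \<in> {a<..b} \<longrightarrow> ennreal (std_normal_density x) = 0"
      by (subst (asm) null_sets_density_iff) auto
    then have "AE x in lborel. x \<notin> {a<..b}"
      by eventually_elim (use normal_density_pos[of 1 0] in \<open>auto simp: ennreal_eq_0_iff not_le[symmetric]\<close>)
    then have "emeasure lborel {a<..b} = 0"
      by (subst (asm) AE_iff_measurable[of "{a<..b}"]) auto
    then show False using assms by simp
  qed
  then show ?thesis
    using N.cdf_diff_eq[OF assms] measure_nonneg[of std_normal_distribution "{a<..b}"] by linarith
qed

text \<open>There are no atoms. Weak convergence thus yields convergence of the distribution
  functions at every point.\<close>

lemma std_normal_cdf_isCont: "isCont (cdf std_normal_distribution) x"
proof -
  interpret N: real_distribution std_normal_distribution by (rule real_dist_normal_dist)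
  have "emeasure std_normal_distribution {x} = 0"
    by (subst emeasure_density) (auto simp: nn_integral_cmult_indicator nn_integral_density
        intro!: nn_integral_null_set)
  then show ?thesis by (simp add: N.isCont_cdf measure_def)
qed

text \<open>Applied contrapositively: growth of the distribution function across an interval
  produces a sample value inside it.\<close>

lemma cdf_eq_of_gap:
  fixes Z :: "'a \<Rightarrow> real"
  assumes "\<And>x. x \<in> set_pmf p \<Longrightarrow> Z x \<notin> {a<..b}" "a \<le> b"
  shows "cdf (distr (measure_pmf p) borel Z) a = cdf (distr (measure_pmf p) borel Z) b"
  unfolding cdf_def
  by (subst (1 2) measure_distr, simp_all) (rule measure_pmf.finite_measure_eq_AE,
    use assms in \<open>force simp: AE_measure_pmf_iff\<close>, simp_all)

text \<open>A lattice of mesh at least \<open>1 / C\<close> misses one of any two adjacent intervals whose total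
  length is below \<open>1 / C\<close>, whereas the normal distribution charges both.\<close>

lemma normal_limit_imp_scale_unbounded:
  fixes X :: "nat \<Rightarrow> 'a \<Rightarrow> nat" and m s :: "nat \<Rightarrow> real"
  assumes conv: "weak_conv_m (\<lambda>n. distr (measure_pmf (p n)) borel (\<lambda>x. (real (X n x) - m n) / s n))
      std_normal_distribution"
    and s: "\<And>n. s n \<ge> 0"
  shows "filterlim s at_top sequentially"
  unfolding filterlim_at_top
proof (rule allI, rule ccontr)
  fix C0 assume "\<not> (\<forall>\<^sub>F n in sequentially. C0 \<le> s n)"
  then have freq: "\<exists>\<^sub>F n in sequentially. s n < C0"
    by (simp add: frequently_def not_less)
  define C where "C = max 1 C0"
  \<comment> \<open>The intervals \<open>{0<..h}\<close> and \<open>{h<..2 * h}\<close> together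
    have length \<open>2 / (3 * C)\<close>, below the mesh bound \<open>1 / C\<close>.\<close>
  define h where "h = 1 / (3 * C)"
  have C: "C > 0" "C0 \<le> C" by (auto simp: C_def)
  have h: "h > 0" using C by (simp add: h_def)
  let ?F = "\<lambda>n. cdf (distr (measure_pmf (p n)) borel (\<lambda>x. (real (X n x) - m n) / s n))"
  let ?G = "cdf std_normal_distribution"
  have lim: "(\<lambda>n. ?F n y) \<longlonglongrightarrow> ?G y" for y
    using conv std_normal_cdf_isCont unfolding weak_conv_m_def weak_conv_def by blast
  have ev: "\<forall>\<^sub>F n in sequentially. ?F n a < ?F n b" if "a < b" for a b
    using order_tendstoD(1)[OF tendsto_diff[OF lim[of b] lim[of a]], of 0]
      std_normal_interval_pos[OF that] by simp
  have "\<forall>\<^sub>F n in sequentially. ?F n 0 < ?F n h \<and> ?F n h < ?F n (2 * h)"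
    using ev[of 0 h] ev[of h "2 * h"] h by (intro eventually_conj) auto
  from frequently_ex[OF frequently_eventually_conj[OF freq this]]
  obtain n where n: "s n < C0" "?F n 0 \<noteq> ?F n h" "?F n h \<noteq> ?F n (2 * h)"
    by auto
  let ?Z = "\<lambda>x. (real (X n x) - m n) / s n"
  obtain x where x: "?Z x \<in> {0<..h}" using cdf_eq_of_gap[of "p n" ?Z 0 h] n(2) h by auto
  obtain y where y: "?Z y \<in> {h<..2 * h}" using cdf_eq_of_gap[of "p n" ?Z h "2 * h"] n(3) h by auto
  \<comment> \<open>If \<open>s n = 0\<close>, division by zero makes every value 0, which lies
    outside \<open>{0<..h}\<close>.\<close>
  have sn: "s n > 0" using x s[of n] by (cases "s n = 0") auto
  have d: "0 < ?Z y - ?Z x" "?Z y - ?Z x < 1 / C" using x y h C by (auto simp: h_def)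
  have e: "?Z y - ?Z x = (real (X n y) - real (X n x)) / s n" by (simp add: diff_divide_distrib)
  have "real (X n y) - real (X n x) > 0" using d(1) sn unfolding e by (simp add: zero_less_divide_iff)
  \<comment> \<open>Integrality enters here: distinct natural numbers differ by at least 1.\<close>
  then have "real (Suc (X n x)) \<le> real (X n y)" by (intro of_nat_mono) simp
  then have "real (X n y) - real (X n x) \<ge> 1" by simp
  then have "?Z y - ?Z x \<ge> 1 / s n" unfolding e using sn by (simp add: divide_right_mono)
  moreover have "1 / s n \<ge> 1 / C" using sn n(1) C by (intro divide_left_mono) auto
  ultimately show False using d(2) by linarith
qed

text \<open>For fixed \<open>t\<close> the bound tends to 0, and Levy's continuity theorem applies.
  The conditions \<open>n \<ge> 1\<close> and \<open>s n > 0\<close> hold eventually, so index 0 and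
  degenerate variances do no harm.\<close>

lemma normal_limit_of_char_estimate:
  fixes X :: "nat \<Rightarrow> 'a \<Rightarrow> real" and s :: "nat \<Rightarrow> real"
  assumes est: "\<And>n t. n \<ge> 1 \<Longrightarrow> s n > 0 \<Longrightarrow>
      cmod (measure_pmf.expectation (p n) (\<lambda>x. iexp (t * X n x)) - exp (- t\<^sup>2 / 2)) \<le> B * \<bar>t\<bar> ^ 3 / s n"
    and s: "filterlim s at_top sequentially"
  shows "weak_conv_m (\<lambda>n. distr (measure_pmf (p n)) borel (X n)) std_normal_distribution"
proof (rule levy_continuity)
  show "real_distribution (distr (measure_pmf (p n)) borel (X n))" for n
    by (intro prob_space.real_distribution_distr measure_pmf.prob_space_axioms) simp
  show "real_distribution std_normal_distribution" by (rule real_dist_normal_dist)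
  fix t
  have ch: "char (distr (measure_pmf (p n)) borel (X n)) t
      = measure_pmf.expectation (p n) (\<lambda>x. iexp (t * X n x))" for n
    unfolding char_def by (subst integral_distr) auto
  have lim: "(\<lambda>n. B * \<bar>t\<bar> ^ 3 / s n) \<longlonglongrightarrow> 0"
    by (intro tendsto_divide_0[OF tendsto_const] filterlim_at_top_imp_at_infinity s)
  have "\<forall>\<^sub>F n in sequentially. n \<ge> 1 \<and> s n > 0"
    using eventually_ge_at_top[of 1] filterlim_at_top_dense[THEN iffD1, OF s, rule_format, of 0]
    by (rule eventually_conj)
  then have "\<forall>\<^sub>F n in sequentially. norm (char (distr (measure_pmf (p n)) borel (X n)) t - exp (- t\<^sup>2 / 2))
      \<le> B * \<bar>t\<bar> ^ 3 / s n"
    by eventually_elim (use est in \<open>simp only: ch\<close>)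
  from Lim_null_comparison[OF this lim]
  show "(\<lambda>n. char (distr (measure_pmf (p n)) borel (X n)) t) \<longlonglongrightarrow> char std_normal_distribution t"
    by (simp add: char_std_normal_distribution LIM_zero_iff)
qed

section \<open>Reflections and the groups they generate\<close>

type_synonym vec = "nat \<Rightarrow> real"

definition linear_fun :: "(vec \<Rightarrow> vec) \<Rightarrow> bool" where
  "linear_fun w \<longleftrightarrow> (\<forall>a b u v. w (\<lambda>i. a * u i + b * v i) = (\<lambda>i. a * w u i + b * w v i))"

lemma linear_fun_comb:
  "linear_fun w \<Longrightarrow> w (\<lambda>i. a * u i + b * v i) = (\<lambda>i. a * w u i + b * w v i)"
  by (simp add: linear_fun_def)

lemma linear_fun_scale: "linear_fun w \<Longrightarrow> w (\<lambda>i. a * u i) = (\<lambda>i. a * w u i)"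
  using linear_fun_comb[of w a u 0 u] by simp

lemma linear_fun_minus: "linear_fun w \<Longrightarrow> w (\<lambda>i. - u i) = (\<lambda>i. - w u i)"
  using linear_fun_scale[of w "-1" u] by simp

lemma linear_fun_zero: "linear_fun w \<Longrightarrow> w (\<lambda>_. 0) = (\<lambda>_. 0)"
  using linear_fun_scale[of w 0 "\<lambda>_. 0"] by simp

lemma linear_fun_lin_comb:
  assumes "linear_fun w" "finite S"
  shows "w (lin_comb S c) = (\<lambda>i. \<Sum>\<beta>\<in>S. c \<beta> * w \<beta> i)"
  using assms(2)
proof (induction S rule: finite_induct)
  case empty
  then show ?case using linear_fun_zero[OF assms(1)] by (simp add: lin_comb_def)
next
  case (insert x S)
  have "lin_comb (insert x S) c = (\<lambda>i. c x * x i + 1 * lin_comb S c i)"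
    using insert.hyps by (simp add: lin_comb_def)
  then have "w (lin_comb (insert x S) c) = (\<lambda>i. c x * w x i + 1 * w (lin_comb S c) i)"
    using linear_fun_comb[OF assms(1)] by presburger
  then show ?case using insert by simp
qed

section \<open>The inner product and single reflections\<close>

lemma ip_comb_left: "ip d (\<lambda>i. a * u i + b * v i) x = a * ip d u x + b * ip d v x"
  by (simp add: ip_def algebra_simps sum.distrib sum_distrib_left)

lemma ip_scale_left: "ip d (\<lambda>i. a * u i) x = a * ip d u x"
  using ip_comb_left[of d a u 0 u] by simp

lemma ip_commute: "ip d u v = ip d v u"
  by (simp add: ip_def mult.commute)

lemma ip_scale_right: "ip d x (\<lambda>i. a * u i) = a * ip d x u"
  using ip_scale_left ip_commute by metis

lemma ip_sum_left:
  "ip d (\<lambda>i. \<Sum>x\<in>S. c x * f x i) y = (\<Sum>x\<in>S. c x * ip d (f x) y)"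
  by (simp add: ip_def sum_distrib_right sum_distrib_left mult.assoc) (rule sum.swap)

lemma ip_nonneg: "ip d x x \<ge> 0"
  by (simp add: ip_def sum_nonneg)

lemma ip_self_eq_0: "x \<in> vspace d \<Longrightarrow> ip d x x = 0 \<Longrightarrow> x = (\<lambda>_. 0)"
proof
  fix i assume x: "x \<in> vspace d" "ip d x x = 0"
  then have "\<forall>i\<in>{..<d}. x i * x i = 0"
    unfolding ip_def by (subst (asm) sum_nonneg_eq_0_iff) auto
  then show "x i = 0" using x(1) by (cases "i < d") (auto simp: vspace_def)
qed

lemma linear_fun_refl: "linear_fun (refl d \<alpha>)"
  unfolding linear_fun_def refl_def ip_comb_left
  by (auto simp: algebra_simps add_divide_distrib)

lemma refl_self: "ip d \<alpha> \<alpha> \<noteq> 0 \<Longrightarrow> refl d \<alpha> \<alpha> = (\<lambda>i. - \<alpha> i)"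
  by (auto simp: refl_def)

lemma refl_involutive: "ip d \<alpha> \<alpha> \<noteq> 0 \<Longrightarrow> refl d \<alpha> (refl d \<alpha> v) = v"
proof -
  assume a: "ip d \<alpha> \<alpha> \<noteq> 0"
  have "refl d \<alpha> v = (\<lambda>i. 1 * v i + (- (2 * ip d v \<alpha> / ip d \<alpha> \<alpha>)) * \<alpha> i)"
    by (simp add: refl_def)
  then have "ip d (refl d \<alpha> v) \<alpha> = - ip d v \<alpha>"
    using a by (simp only: ip_comb_left) simp
  then show ?thesis by (subst refl_def) (auto simp: refl_def)
qed

lemma refl_orthogonal: "ip d v \<alpha> = 0 \<Longrightarrow> refl d \<alpha> v = v"
  by (simp add: refl_def)

lemma ip_refl: "ip d \<alpha> \<alpha> \<noteq> 0 \<Longrightarrow> ip d (refl d \<alpha> u) (refl d \<alpha> v) = ip d u v"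
proof -
  assume a: "ip d \<alpha> \<alpha> \<noteq> 0"
  have r: "refl d \<alpha> v = (\<lambda>i. 1 * v i + (- (2 * ip d v \<alpha> / ip d \<alpha> \<alpha>)) * \<alpha> i)" for v
    by (simp add: refl_def)
  have "ip d (refl d \<alpha> u) (refl d \<alpha> v)
    = ip d u (refl d \<alpha> v) - 2 * ip d u \<alpha> / ip d \<alpha> \<alpha> * ip d \<alpha> (refl d \<alpha> v)"
    using ip_comb_left[of d 1 u "- (2 * ip d u \<alpha> / ip d \<alpha> \<alpha>)" \<alpha> "refl d \<alpha> v"] r[of u] by simp
  also have "ip d u (refl d \<alpha> v) = ip d u v - 2 * ip d v \<alpha> / ip d \<alpha> \<alpha> * ip d u \<alpha>"
    by (subst ip_commute, subst r) (simp only: ip_comb_left, simp add: ip_commute)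
  also have "ip d \<alpha> (refl d \<alpha> v) = - ip d v \<alpha>"
    by (subst ip_commute, subst r) (use a in \<open>simp only: ip_comb_left, simp add: ip_commute\<close>)
  finally show ?thesis using a by (simp add: field_simps ip_commute)
qed

section \<open>Elements of groups generated by reflections\<close>

lemma coxeter_group_refl: "\<alpha> \<in> \<Phi> \<Longrightarrow> refl d \<alpha> \<in> coxeter_group d \<Phi>"
  using coxeter_group.step[OF _ coxeter_group.id, of \<alpha> \<Phi> d] by simp

lemma coxeter_group_mult:
  "v \<in> coxeter_group d \<Phi> \<Longrightarrow> w \<in> coxeter_group d \<Phi> \<Longrightarrow> v \<circ> w \<in> coxeter_group d \<Phi>"
  by (induction rule: coxeter_group.induct) (auto simp: comp_assoc intro: coxeter_group.step)

lemma coxeter_group_mono: "J \<subseteq> \<Phi> \<Longrightarrow> coxeter_group d J \<subseteq> coxeter_group d \<Phi>"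
proof
  fix w assume "J \<subseteq> \<Phi>" "w \<in> coxeter_group d J"
  from this(2,1) show "w \<in> coxeter_group d \<Phi>"
    by induction (auto intro: coxeter_group.intros)
qed

lemma coxeter_group_linear: "w \<in> coxeter_group d \<Phi> \<Longrightarrow> linear_fun w"
proof (induction rule: coxeter_group.induct)
  case id
  then show ?case by (simp add: linear_fun_def)
next
  case (step \<alpha> w)
  then show ?case using linear_fun_refl[of d \<alpha>] by (simp add: linear_fun_def)
qed

lemma coxeter_group_inverse:
  assumes "\<And>\<alpha>. \<alpha> \<in> \<Phi> \<Longrightarrow> ip d \<alpha> \<alpha> \<noteq> 0" "w \<in> coxeter_group d \<Phi>"
  shows "\<exists>v\<in>coxeter_group d \<Phi>. v \<circ> w = id \<and> w \<circ> v = id"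
  using assms(2)
proof (induction rule: coxeter_group.induct)
  case id
  show ?case by (rule bexI[OF _ coxeter_group.id]) simp
next
  case (step \<alpha> w)
  then obtain v where v: "v \<in> coxeter_group d \<Phi>" "v \<circ> w = id" "w \<circ> v = id" by blast
  have r: "refl d \<alpha> \<circ> refl d \<alpha> = id"
    using refl_involutive assms(1) step.hyps(1) by fastforce
  have "(v \<circ> refl d \<alpha>) \<circ> (refl d \<alpha> \<circ> w) = v \<circ> (refl d \<alpha> \<circ> refl d \<alpha>) \<circ> w"
    "(refl d \<alpha> \<circ> w) \<circ> (v \<circ> refl d \<alpha>) = refl d \<alpha> \<circ> (w \<circ> v) \<circ> refl d \<alpha>" by (auto simp: comp_assoc)
  then have "(v \<circ> refl d \<alpha>) \<circ> (refl d \<alpha> \<circ> w) = id" "(refl d \<alpha> \<circ> w) \<circ> (v \<circ> refl d \<alpha>) = id"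
    using v r by auto
  then show ?case
    using coxeter_group_mult[OF v(1) coxeter_group_refl[OF step.hyps(1)]] by blast
qed

lemma coxeter_group_right_mult_bij:
  assumes "\<And>\<alpha>. \<alpha> \<in> \<Phi> \<Longrightarrow> ip d \<alpha> \<alpha> \<noteq> 0" "u \<in> coxeter_group d \<Phi>"
  shows "bij_betw (\<lambda>w. w \<circ> u) (coxeter_group d \<Phi>) (coxeter_group d \<Phi>)"
proof -
  obtain v where v: "v \<in> coxeter_group d \<Phi>" "v \<circ> u = id" "u \<circ> v = id"
    using coxeter_group_inverse[OF assms] by auto
  show ?thesis
    by (rule bij_betwI[where g = "\<lambda>w. w \<circ> v"])
       (use v assms(2) in \<open>auto simp: comp_assoc intro: coxeter_group_mult\<close>)
qed

lemma coxeter_group_left_mult_bij: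
  assumes "\<And>\<alpha>. \<alpha> \<in> \<Phi> \<Longrightarrow> ip d \<alpha> \<alpha> \<noteq> 0" "u \<in> coxeter_group d \<Phi>"
  shows "bij_betw (\<lambda>w. u \<circ> w) (coxeter_group d \<Phi>) (coxeter_group d \<Phi>)"
proof -
  obtain v where v: "v \<in> coxeter_group d \<Phi>" "v \<circ> u = id" "u \<circ> v = id"
    using coxeter_group_inverse[OF assms] by auto
  show ?thesis
    by (rule bij_betwI[where g = "\<lambda>w. v \<circ> w"])
       (use v assms(2) in \<open>auto simp: comp_assoc[symmetric] intro: coxeter_group_mult\<close>)
qed

lemma coxeter_group_fixes_orthogonal:
  assumes "w \<in> coxeter_group d J" "\<And>\<alpha>. \<alpha> \<in> J \<Longrightarrow> ip d v \<alpha> = 0"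
  shows "w v = v"
  using assms by induction (auto simp: refl_orthogonal)

text \<open>Each reflection adds a multiple of its own root. This confines the action on the span of
  \<open>J\<close> to that span, and it controls vectors outside the span of the roots.\<close>

lemma coxeter_group_displacement:
  assumes "finite J" "w \<in> coxeter_group d J"
  shows "\<exists>c. w v = (\<lambda>i. v i + lin_comb J c i)"
  using assms(2)
proof (induction rule: coxeter_group.induct)
  case id
  then show ?case by (intro exI[of _ "\<lambda>_. 0"]) (simp add: lin_comb_def)
next
  case (step \<alpha> w)
  then obtain c where c: "w v = (\<lambda>i. v i + lin_comb J c i)" by auto
  define k where "k = 2 * ip d (w v) \<alpha> / ip d \<alpha> \<alpha>"
  have "lin_comb J (\<lambda>\<beta>. c \<beta> - (if \<beta> = \<alpha> then k else 0)) i = lin_comb J c i - k * \<alpha> i" for i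
    using step.hyps(1) assms(1)
    by (simp add: lin_comb_def left_diff_distrib sum_subtractf if_distrib[where f="\<lambda>x. x * _"] cong: if_cong)
  moreover have "(refl d \<alpha> \<circ> w) v = (\<lambda>i. w v i - k * \<alpha> i)"
    by (simp add: refl_def k_def)
  ultimately have "(refl d \<alpha> \<circ> w) v = (\<lambda>i. v i + lin_comb J (\<lambda>\<beta>. c \<beta> - (if \<beta> = \<alpha> then k else 0)) i)"
    using c by auto
  then show ?case by blast
qed

lemma ip_coxeter_group:
  assumes "\<And>\<alpha>. \<alpha> \<in> \<Phi> \<Longrightarrow> ip d \<alpha> \<alpha> \<noteq> 0" "w \<in> coxeter_group d \<Phi>"
  shows "ip d (w u) (w v) = ip d u v"
  using assms(2) by induction (auto simp: ip_refl assms(1))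

section \<open>Positive roots and coset representatives\<close>

locale simple_roots =
  fixes d :: nat and \<Phi> \<Delta> :: "vec set"
  assumes root_system: "root_system d \<Phi>" and simple_system: "simple_system \<Phi> \<Delta>"
begin

abbreviation W :: "(vec \<Rightarrow> vec) set" where "W \<equiv> coxeter_group d \<Phi>"

text \<open>The closed cone spanned by \<open>\<Delta>\<close>, defined for arbitrary vectors and
  containing zero; on roots it is the usual positivity.\<close>

definition pos :: "vec \<Rightarrow> bool" where
  "pos v \<longleftrightarrow> (\<exists>c. v = lin_comb \<Delta> c \<and> (\<forall>\<beta>\<in>\<Delta>. c \<beta> \<ge> 0))"

lemma finite_roots: "finite \<Phi>"
  using root_system by (simp add: root_system_def)

lemma finite_simple: "finite \<Delta>"
  using simple_system by (simp add: simple_system_def lin_indep_def)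

lemma simple_subset: "\<Delta> \<subseteq> \<Phi>"
  using simple_system by (simp add: simple_system_def)

lemma simple_root: "\<beta> \<in> \<Delta> \<Longrightarrow> \<beta> \<in> \<Phi>"
  using simple_subset by blast

lemma root_nonzero: "\<alpha> \<in> \<Phi> \<Longrightarrow> \<alpha> \<noteq> (\<lambda>_. 0)"
  using root_system by (auto simp: root_system_def)

lemma root_vspace: "\<alpha> \<in> \<Phi> \<Longrightarrow> \<alpha> \<in> vspace d"
  using root_system by (auto simp: root_system_def)

lemma root_ip_nonzero: "\<alpha> \<in> \<Phi> \<Longrightarrow> ip d \<alpha> \<alpha> \<noteq> 0"
  using ip_self_eq_0 root_nonzero root_vspace by blast

lemma root_ip_pos: "\<alpha> \<in> \<Phi> \<Longrightarrow> ip d \<alpha> \<alpha> > 0"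
  using root_ip_nonzero ip_nonneg[of d \<alpha>] by fastforce

lemma root_scale: "\<alpha> \<in> \<Phi> \<Longrightarrow> (\<lambda>i. c * \<alpha> i) \<in> \<Phi> \<longleftrightarrow> c = 1 \<or> c = -1"
  using root_system by (auto simp: root_system_def)

lemma root_uminus: "\<alpha> \<in> \<Phi> \<Longrightarrow> (\<lambda>i. - \<alpha> i) \<in> \<Phi>"
  using root_scale[of \<alpha> "-1"] by simp

lemma refl_root: "\<alpha> \<in> \<Phi> \<Longrightarrow> \<beta> \<in> \<Phi> \<Longrightarrow> refl d \<alpha> \<beta> \<in> \<Phi>"
  using root_system unfolding root_system_def by blast

lemma W_root: "w \<in> W \<Longrightarrow> \<alpha> \<in> \<Phi> \<Longrightarrow> w \<alpha> \<in> \<Phi>"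
  by (induction rule: coxeter_group.induct) (auto intro: refl_root)

text \<open>Group elements act on all functions, not just on the span of the roots. The displacement
  of \<open>v\<close> lies in that span, and by invariance of \<open>ip\<close> it is orthogonal to
  every root, so it vanishes.\<close>

lemma coxeter_group_fixing_roots:
  assumes "w \<in> W" "\<And>\<alpha>. \<alpha> \<in> \<Phi> \<Longrightarrow> w \<alpha> = \<alpha>"
  shows "w = id"
proof
  fix v
  obtain c where c: "w v = (\<lambda>i. v i + lin_comb \<Phi> c i)"
    using coxeter_group_displacement[OF finite_roots assms(1)] by blast
  let ?x = "lin_comb \<Phi> c"
  have o: "ip d ?x \<alpha> = 0" if "\<alpha> \<in> \<Phi>" for \<alpha>
  proof -
    have "ip d (w v) \<alpha> = ip d v \<alpha>"
      using ip_coxeter_group[OF root_ip_nonzero assms(1), of v \<alpha>] assms(2)[OF that] by simp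
    then show ?thesis
      using ip_comb_left[of d 1 v 1 ?x \<alpha>] c by simp
  qed
  have "ip d ?x ?x = (\<Sum>\<alpha>\<in>\<Phi>. c \<alpha> * ip d \<alpha> ?x)"
    by (subst lin_comb_def) (rule ip_sum_left)
  also have "\<dots> = 0" using o by (simp add: ip_commute)
  finally have "ip d ?x ?x = 0" .
  moreover have "?x \<in> vspace d"
    using root_vspace by (auto simp: vspace_def lin_comb_def intro!: sum.neutral)
  ultimately have "?x = (\<lambda>_. 0)" using ip_self_eq_0 by blast
  with c show "w v = id v" by (simp add: fun_eq_iff)
qed

text \<open>By the previous lemma an element is determined by its action on the finite set
  \<open>\<Phi>\<close>.\<close>

lemma finite_W: "finite W"
proof (rule inj_on_finite)
  show "inj_on (\<lambda>w. restrict w \<Phi>) W"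
  proof (rule inj_onI)
    fix w w' assume w: "w \<in> W" "w' \<in> W" "restrict w \<Phi> = restrict w' \<Phi>"
    obtain v where v: "v \<in> W" "v \<circ> w' = id" "w' \<circ> v = id"
      using coxeter_group_inverse[OF root_ip_nonzero w(2)] by blast
    have "w \<alpha> = w' \<alpha>" if "\<alpha> \<in> \<Phi>" for \<alpha>
      using w(3) that by (metis restrict_apply')
    then have "(v \<circ> w) \<alpha> = \<alpha>" if "\<alpha> \<in> \<Phi>" for \<alpha>
      using v(2) that by (metis comp_apply id_apply)
    then have "v \<circ> w = id"
      using coxeter_group_fixing_roots coxeter_group_mult[OF v(1) w(1)] by blast
    then have "w' \<circ> (v \<circ> w) = w'" by simp
    then show "w = w'" using v(3) by (simp add: comp_assoc[symmetric])
  qed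
  show "(\<lambda>w. restrict w \<Phi>) ` W \<subseteq> (\<Pi>\<^sub>E \<alpha>\<in>\<Phi>. \<Phi>)"
    using W_root by auto
  show "finite (\<Pi>\<^sub>E \<alpha>\<in>\<Phi>. \<Phi>)"
    using finite_roots by (intro finite_PiE) auto
qed

lemma W_nonempty: "W \<noteq> {}"
  using coxeter_group.id by blast

lemma card_W_pos: "card W > 0"
  using finite_W W_nonempty by (simp add: card_gt_0_iff)

lemma lin_comb_unique:
  assumes "lin_comb \<Delta> c = lin_comb \<Delta> c'" "\<beta> \<in> \<Delta>"
  shows "c \<beta> = c' \<beta>"
proof -
  have "lin_comb \<Delta> (\<lambda>\<beta>. c \<beta> - c' \<beta>) = (\<lambda>_. 0)"
    using fun_cong[OF assms(1)] by (auto simp: lin_comb_def left_diff_distrib sum_subtractf)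
  then have "c \<beta> - c' \<beta> = 0"
    using simple_system assms(2) unfolding simple_system_def lin_indep_def by meson
  then show ?thesis by simp
qed

lemma simple_lin_comb:
  assumes "\<beta> \<in> \<Delta>" shows "\<beta> = lin_comb \<Delta> (\<lambda>\<gamma>. if \<gamma> = \<beta> then 1 else 0)"
  using assms finite_simple
  by (auto simp: lin_comb_def if_distrib[where f="\<lambda>x. x * _"] cong: if_cong)

lemma pos_simple: "\<beta> \<in> \<Delta> \<Longrightarrow> pos \<beta>"
  unfolding pos_def by (intro exI[of _ "\<lambda>\<gamma>. if \<gamma> = \<beta> then 1 else 0"]) (simp add: simple_lin_comb)

lemma pos_comb2:
  assumes "pos u" "pos v" "a \<ge> 0" "b \<ge> 0"
  shows "pos (\<lambda>i. a * u i + b * v i)"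
proof -
  obtain c c' where c: "u = lin_comb \<Delta> c" "\<forall>\<beta>\<in>\<Delta>. c \<beta> \<ge> 0"
    "v = lin_comb \<Delta> c'" "\<forall>\<beta>\<in>\<Delta>. c' \<beta> \<ge> 0"
    using assms(1,2) unfolding pos_def by blast
  have "(\<lambda>i. a * u i + b * v i) = lin_comb \<Delta> (\<lambda>\<beta>. a * c \<beta> + b * c' \<beta>)"
    by (auto simp: c lin_comb_def sum_distrib_left sum.distrib algebra_simps)
  then show ?thesis unfolding pos_def using c(2,4) assms(3,4)
    by (intro exI[of _ "\<lambda>\<beta>. a * c \<beta> + b * c' \<beta>"]) auto
qed

lemma pos_zero: "pos (\<lambda>_. 0)"
  unfolding pos_def by (intro exI[of _ "\<lambda>_. 0"]) (simp add: lin_comb_def)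

lemma pos_sum:
  assumes "finite J" "\<And>\<beta>. \<beta> \<in> J \<Longrightarrow> c \<beta> \<ge> 0" "\<And>\<beta>. \<beta> \<in> J \<Longrightarrow> pos (f \<beta>)"
  shows "pos (\<lambda>i. \<Sum>\<beta>\<in>J. c \<beta> * f \<beta> i)"
  using assms
proof (induction J rule: finite_induct)
  case empty
  then show ?case by (simp add: pos_zero)
next
  case (insert x J)
  then show ?case using pos_comb2[of "f x" "\<lambda>i. \<Sum>\<beta>\<in>J. c \<beta> * f \<beta> i" "c x" 1] by simp
qed

lemma pos_scale: "k > 0 \<Longrightarrow> pos (\<lambda>i. k * v i) \<longleftrightarrow> pos v"
  using pos_comb2[of v v k 0] pos_comb2[of "\<lambda>i. k * v i" v "1/k" 0]
    pos_comb2[of "\<lambda>i. k * v i" "\<lambda>i. k * v i" "1/k" 0] by auto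

lemma pos_antisym:
  assumes "pos v" "pos (\<lambda>i. - v i)" shows "v = (\<lambda>_. 0)"
proof -
  obtain c c' where c: "v = lin_comb \<Delta> c" "\<forall>\<beta>\<in>\<Delta>. c \<beta> \<ge> 0"
    "(\<lambda>i. - v i) = lin_comb \<Delta> c'" "\<forall>\<beta>\<in>\<Delta>. c' \<beta> \<ge> 0"
    using assms unfolding pos_def by blast
  have "lin_comb \<Delta> (\<lambda>\<beta>. - c' \<beta>) = lin_comb \<Delta> c"
  proof
    fix i
    show "lin_comb \<Delta> (\<lambda>\<beta>. - c' \<beta>) i = lin_comb \<Delta> c i"
      using fun_cong[OF c(3), of i] by (simp add: c(1) lin_comb_def sum_negf)
  qed
  then have "c \<beta> = 0" if "\<beta> \<in> \<Delta>" for \<beta>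
    using lin_comb_unique[of "\<lambda>\<beta>. - c' \<beta>" c \<beta>] that c(2,4) by fastforce
  then show ?thesis by (simp add: c(1) lin_comb_def)
qed

lemma root_pos_or_neg: "\<alpha> \<in> \<Phi> \<Longrightarrow> pos \<alpha> \<or> pos (\<lambda>i. - \<alpha> i)"
proof -
  assume "\<alpha> \<in> \<Phi>"
  then obtain c where c: "\<alpha> = lin_comb \<Delta> c" "(\<forall>\<beta>\<in>\<Delta>. c \<beta> \<ge> 0) \<or> (\<forall>\<beta>\<in>\<Delta>. c \<beta> \<le> 0)"
    using simple_system unfolding simple_system_def by blast
  have "(\<lambda>i. - \<alpha> i) = lin_comb \<Delta> (\<lambda>\<beta>. - c \<beta>)"
    by (simp add: c(1) lin_comb_def sum_negf)
  with c show ?thesis unfolding pos_def by (metis neg_0_le_iff_le)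
qed

lemma pos_uminus_root: "\<alpha> \<in> \<Phi> \<Longrightarrow> pos (\<lambda>i. - \<alpha> i) \<longleftrightarrow> \<not> pos \<alpha>"
  using root_pos_or_neg pos_antisym root_nonzero by blast

lemma neg_roots_iff: "\<alpha> \<in> \<Phi> \<Longrightarrow> \<alpha> \<in> neg_roots \<Phi> \<Delta> \<longleftrightarrow> \<not> pos \<alpha>"
proof -
  assume a: "\<alpha> \<in> \<Phi>"
  have "\<alpha> \<in> neg_roots \<Phi> \<Delta> \<longleftrightarrow> pos (\<lambda>i. - \<alpha> i)"
  proof
    assume "\<alpha> \<in> neg_roots \<Phi> \<Delta>"
    then obtain c where "\<alpha> = lin_comb \<Delta> c" "\<forall>\<beta>\<in>\<Delta>. c \<beta> \<le> 0" by (auto simp: neg_roots_def)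
    then show "pos (\<lambda>i. - \<alpha> i)" unfolding pos_def
      by (intro exI[of _ "\<lambda>\<beta>. - c \<beta>"]) (auto simp: lin_comb_def sum_negf)
  next
    assume "pos (\<lambda>i. - \<alpha> i)"
    then obtain c where c: "(\<lambda>i. - \<alpha> i) = lin_comb \<Delta> c" "\<forall>\<beta>\<in>\<Delta>. c \<beta> \<ge> 0"
      unfolding pos_def by blast
    have "\<alpha> i = lin_comb \<Delta> (\<lambda>\<beta>. - c \<beta>) i" for i
      using fun_cong[OF c(1), of i] by (simp add: lin_comb_def sum_negf)
    then have "\<alpha> = lin_comb \<Delta> (\<lambda>\<beta>. - c \<beta>)" by blast
    then show "\<alpha> \<in> neg_roots \<Phi> \<Delta>" using a c(2)
      by (auto simp: neg_roots_def intro!: exI[of _ "\<lambda>\<beta>. - c \<beta>"])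
  qed
  then show ?thesis using pos_uminus_root[OF a] by simp
qed

lemma pos_root_coeffs:
  assumes "\<alpha> \<in> \<Phi>" "\<alpha> = lin_comb \<Delta> c" "\<beta> \<in> \<Delta>" "pos \<alpha>"
  shows "c \<beta> \<ge> 0"
  using assms lin_comb_unique unfolding pos_def by metis

lemma neg_root_coeffs:
  assumes "\<alpha> \<in> \<Phi>" "\<alpha> = lin_comb \<Delta> c" "\<beta> \<in> \<Delta>" "\<not> pos \<alpha>"
  shows "c \<beta> \<le> 0"
proof -
  have "(\<lambda>i. - \<alpha> i) = lin_comb \<Delta> (\<lambda>\<beta>. - c \<beta>)"
    by (simp add: assms(2) lin_comb_def sum_negf)
  then have "- c \<beta> \<ge> 0"
    using pos_root_coeffs[OF root_uminus[OF assms(1)] _ assms(3), of "\<lambda>\<beta>. - c \<beta>"]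
      pos_uminus_root[OF assms(1)] assms(4) by blast
  then show ?thesis by simp
qed

lemma refl_simple_lin_comb:
  assumes "\<beta> \<in> \<Delta>"
  shows "\<exists>k. refl d \<beta> (lin_comb \<Delta> c) = lin_comb \<Delta> (c(\<beta> := k))"
proof -
  define k where "k = 2 * ip d (lin_comb \<Delta> c) \<beta> / ip d \<beta> \<beta>"
  have "refl d \<beta> (lin_comb \<Delta> c) i = lin_comb \<Delta> (c(\<beta> := c \<beta> - k)) i" for i
  proof -
    have "lin_comb \<Delta> (c(\<beta> := c \<beta> - k)) i = lin_comb \<Delta> c i - k * \<beta> i"
      using assms finite_simple by (simp add: lin_comb_def sum.remove[of \<Delta> \<beta>] algebra_simps)
    then show ?thesis by (simp add: refl_def k_def)
  qed
  then show ?thesis by blast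
qed

text \<open>Only the coefficient of \<open>\<beta>\<close> changes. If the image were negative, all
  other coefficients of \<open>\<alpha>\<close> would be zero, making \<open>\<alpha>\<close> a
  multiple of \<open>\<beta>\<close> and hence \<open>\<beta>\<close> itself.\<close>

lemma refl_simple_pos:
  assumes "\<beta> \<in> \<Delta>" "\<alpha> \<in> \<Phi>" "pos \<alpha>" "\<alpha> \<noteq> \<beta>"
  shows "pos (refl d \<beta> \<alpha>)"
proof (rule ccontr)
  assume n: "\<not> pos (refl d \<beta> \<alpha>)"
  obtain c where c: "\<alpha> = lin_comb \<Delta> c" "\<forall>\<gamma>\<in>\<Delta>. c \<gamma> \<ge> 0"
    using assms(3) unfolding pos_def by blast
  obtain k where k: "refl d \<beta> \<alpha> = lin_comb \<Delta> (c(\<beta> := k))"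
    using refl_simple_lin_comb[OF assms(1), of c] c(1) by auto
  have "c \<gamma> = 0" if "\<gamma> \<in> \<Delta>" "\<gamma> \<noteq> \<beta>" for \<gamma>
  proof -
    have "(c(\<beta> := k)) \<gamma> \<le> 0"
      using neg_root_coeffs[OF refl_root[OF simple_root[OF assms(1)] assms(2)] k that(1) n] .
    then show ?thesis using that c(2) by force
  qed
  then have "\<alpha> = (\<lambda>i. c \<beta> * \<beta> i)"
    using c(1) assms(1) finite_simple by (auto simp: lin_comb_def sum.remove[of \<Delta> \<beta>])
  moreover from this have "c \<beta> = 1 \<or> c \<beta> = -1"
    using root_scale[OF simple_root[OF assms(1)], of "c \<beta>"] assms(2) by simp
  ultimately show False using assms(1,4) c(2) by force
qed

text \<open>The image of \<open>\<gamma>\<close> under the reflection in \<open>\<beta>\<close> is a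
  positive root, and its coefficient at \<open>\<beta>\<close> is \<open>- k\<close>.\<close>

lemma ip_simple_nonpos:
  assumes "\<beta> \<in> \<Delta>" "\<gamma> \<in> \<Delta>" "\<beta> \<noteq> \<gamma>"
  shows "ip d \<beta> \<gamma> \<le> 0"
proof -
  define k where "k = 2 * ip d \<gamma> \<beta> / ip d \<beta> \<beta>"
  let ?c = "\<lambda>\<delta>. (if \<delta> = \<gamma> then 1 else 0) - k * (if \<delta> = \<beta> then 1 else 0)"
  have "refl d \<beta> \<gamma> i = lin_comb \<Delta> ?c i" for i
  proof -
    have "lin_comb \<Delta> ?c i = lin_comb \<Delta> (\<lambda>\<delta>. if \<delta> = \<gamma> then 1 else 0) i - k * lin_comb \<Delta> (\<lambda>\<delta>. if \<delta> = \<beta> then 1 else 0) i"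
      by (simp only: lin_comb_def left_diff_distrib sum_subtractf sum_distrib_left mult.assoc)
    also have "\<dots> = \<gamma> i - k * \<beta> i"
      using simple_lin_comb[OF assms(1)] simple_lin_comb[OF assms(2)] by simp
    finally show ?thesis by (simp add: refl_def k_def)
  qed
  then have "refl d \<beta> \<gamma> = lin_comb \<Delta> ?c" by blast
  moreover have "refl d \<beta> \<gamma> \<in> \<Phi>" "pos (refl d \<beta> \<gamma>)"
    using assms simple_root refl_root refl_simple_pos pos_simple by auto
  ultimately have "?c \<beta> \<ge> 0" using pos_root_coeffs assms(1) by blast
  then have "k \<le> 0" using assms(3) by simp
  then show ?thesis
    using root_ip_pos[OF simple_root[OF assms(1)]]
    by (simp add: k_def field_simps ip_commute divide_le_0_iff mult_le_0_iff not_less[symmetric])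
qed

text \<open>The cardinality is the Coxeter length; it serves as the measure to be minimised within a
  coset.\<close>

definition inversions :: "(vec \<Rightarrow> vec) \<Rightarrow> vec set" where
  "inversions w = {\<alpha>\<in>\<Phi>. pos \<alpha> \<and> \<not> pos (w \<alpha>)}"

text \<open>The reflection permutes the positive roots other than \<open>\<beta>\<close>, so it maps
  the new inversions injectively into the old ones; \<open>\<beta>\<close> is an old inversion that
  is missed.\<close>

lemma card_inversions_refl:
  assumes "w \<in> W" "\<beta> \<in> \<Delta>" "\<not> pos (w \<beta>)"
  shows "card (inversions (w \<circ> refl d \<beta>)) < card (inversions w)"
proof -
  have b: "\<beta> \<in> \<Phi>" "ip d \<beta> \<beta> \<noteq> 0" using assms(2) simple_root root_ip_nonzero by auto
  have "refl d \<beta> ` inversions (w \<circ> refl d \<beta>) \<subseteq> inversions w - {\<beta>}"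
  proof
    fix x assume "x \<in> refl d \<beta> ` inversions (w \<circ> refl d \<beta>)"
    then obtain \<alpha> where \<alpha>: "\<alpha> \<in> \<Phi>" "pos \<alpha>" "\<not> pos (w (refl d \<beta> \<alpha>))" "x = refl d \<beta> \<alpha>"
      by (auto simp: inversions_def)
    have "pos (w (refl d \<beta> \<beta>))"
      using assms(3) pos_uminus_root[OF W_root[OF assms(1) b(1)]]
      by (simp add: refl_self b(2) linear_fun_minus[OF coxeter_group_linear[OF assms(1)]])
    with \<alpha> have "\<alpha> \<noteq> \<beta>" by auto
    moreover have "x \<noteq> \<beta>"
    proof
      assume "x = \<beta>"
      then have "\<alpha> = (\<lambda>i. - \<beta> i)"
        using \<alpha>(4) refl_involutive[OF b(2), of \<alpha>] refl_self[OF b(2)] by simp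
      then show False
        using \<alpha>(2) pos_uminus_root[OF b(1)] pos_simple[OF assms(2)] by simp
    qed
    ultimately show "x \<in> inversions w - {\<beta>}"
      using \<alpha> refl_root[OF b(1) \<alpha>(1)] refl_simple_pos[OF assms(2) \<alpha>(1,2)]
      by (auto simp: inversions_def)
  qed
  moreover have "inj_on (refl d \<beta>) (inversions (w \<circ> refl d \<beta>))"
    using refl_involutive[OF b(2)] by (metis inj_onI)
  moreover have "finite (inversions w)" using finite_roots by (simp add: inversions_def)
  ultimately have "card (inversions (w \<circ> refl d \<beta>)) \<le> card (inversions w - {\<beta>})"
    by (metis card_image card_mono finite_Diff)
  also have "\<dots> < card (inversions w)"
    using \<open>finite (inversions w)\<close> assms pos_simple b
    by (intro psubset_card_mono) (auto simp: inversions_def)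
  finally show ?thesis .
qed

text \<open>Take \<open>u\<close> minimising the number of inversions of \<open>w \<circ> u\<close>;
  any \<open>\<beta> \<in> J\<close> sent to a negative root would allow a further decrease.\<close>

lemma parabolic_coset_rep:
  assumes "J \<subseteq> \<Delta>" "w \<in> W"
  shows "\<exists>u\<in>coxeter_group d J. \<forall>\<beta>\<in>J. pos (w (u \<beta>))"
proof -
  have sub: "coxeter_group d J \<subseteq> W"
    using assms(1) simple_subset by (intro coxeter_group_mono) auto
  obtain u where u: "u \<in> coxeter_group d J"
    "\<And>v. v \<in> coxeter_group d J \<Longrightarrow> card (inversions (w \<circ> u)) \<le> card (inversions (w \<circ> v))"
    using ex_has_least_nat[of "\<lambda>u. u \<in> coxeter_group d J" id "\<lambda>u. card (inversions (w \<circ> u))"]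
      coxeter_group.id by blast
  have "pos (w (u \<beta>))" if "\<beta> \<in> J" for \<beta>
  proof (rule ccontr)
    assume "\<not> pos (w (u \<beta>))"
    then have "card (inversions (w \<circ> u \<circ> refl d \<beta>)) < card (inversions (w \<circ> u))"
      using card_inversions_refl[of "w \<circ> u" \<beta>] coxeter_group_mult[OF assms(2)] u(1) sub that assms(1)
      by auto
    moreover have "u \<circ> refl d \<beta> \<in> coxeter_group d J"
      using u(1) that coxeter_group_mult coxeter_group_refl by blast
    ultimately show False using u(2)[of "u \<circ> refl d \<beta>"] by (simp add: comp_assoc)
  qed
  with u(1) show ?thesis by blast
qed

end

section \<open>Independence of descents in orthogonal sets\<close>

lemma scaleR_cross_eq:
  fixes x y :: "'b::real_vector"
  assumes "a \<noteq> 0" "b \<noteq> 0" "a *\<^sub>R x = b *\<^sub>R y"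
  shows "y /\<^sub>R a = x /\<^sub>R b"
proof -
  have "y /\<^sub>R a = (inverse a * inverse b) *\<^sub>R (b *\<^sub>R y)" using assms(2) by simp
  also have "\<dots> = x /\<^sub>R b" using assms(1) by (simp flip: assms(3))
  finally show ?thesis .
qed

context simple_roots
begin

definition descent_determined :: "vec set \<Rightarrow> ((vec \<Rightarrow> vec) \<Rightarrow> 'b) \<Rightarrow> bool" where
  "descent_determined J f \<longleftrightarrow>
     (\<forall>w\<in>W. \<forall>w'\<in>W. (\<forall>\<beta>\<in>J. pos (w \<beta>) \<longleftrightarrow> pos (w' \<beta>)) \<longrightarrow> f w = f w')"

lemma descent_determinedD:
  "descent_determined J f \<Longrightarrow> w \<in> W \<Longrightarrow> w' \<in> W \<Longrightarrow> (\<And>\<beta>. \<beta> \<in> J \<Longrightarrow> pos (w \<beta>) \<longleftrightarrow> pos (w' \<beta>)) \<Longrightarrow> f w = f w'"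
  unfolding descent_determined_def by blast

lemma parabolic_subset: "J \<subseteq> \<Delta> \<Longrightarrow> coxeter_group d J \<subseteq> W"
  using simple_subset by (intro coxeter_group_mono) auto

lemma finite_parabolic: "J \<subseteq> \<Delta> \<Longrightarrow> finite (coxeter_group d J)"
  by (rule finite_subset[OF parabolic_subset finite_W])

lemma parabolic_nonempty: "coxeter_group d J \<noteq> {}"
  by (rule ex_in_conv[THEN iffD1, OF exI]) (rule coxeter_group.id)

lemma parabolic_lin_comb:
  assumes "J \<subseteq> \<Delta>" "u \<in> coxeter_group d J" "\<beta> \<in> J"
  shows "\<exists>c. u \<beta> = lin_comb J c"
proof -
  have f: "finite J" by (rule finite_subset[OF assms(1) finite_simple])
  obtain c where c: "u \<beta> = (\<lambda>i. \<beta> i + lin_comb J c i)"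
    using coxeter_group_displacement[OF f assms(2)] by blast
  have "lin_comb J (c(\<beta> := c \<beta> + 1)) i = \<beta> i + lin_comb J c i" for i
    using f assms(3) by (simp add: lin_comb_def sum.remove[of J \<beta>] algebra_simps)
  then have "u \<beta> = lin_comb J (c(\<beta> := c \<beta> + 1))" unfolding c by (intro ext) simp
  then show ?thesis by blast
qed

text \<open>The root \<open>u \<beta>\<close> is a combination of \<open>J\<close> with coefficients
  of one sign, and \<open>r\<close> maps \<open>J\<close> into the positive cone, so the sign
  survives.\<close>

lemma pos_parabolic:
  assumes "J \<subseteq> \<Delta>" "r \<in> W" "\<And>\<beta>. \<beta> \<in> J \<Longrightarrow> pos (r \<beta>)" "u \<in> coxeter_group d J" "\<beta> \<in> J"
  shows "pos (r (u \<beta>)) \<longleftrightarrow> pos (u \<beta>)"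
proof -
  have f: "finite J" by (rule finite_subset[OF assms(1) finite_simple])
  have u: "u \<in> W" using parabolic_subset assms(1,4) by blast
  have ub: "u \<beta> \<in> \<Phi>" using W_root[OF u] assms(1,5) simple_root by blast
  obtain c where c: "u \<beta> = lin_comb J c" using parabolic_lin_comb assms by blast
  \<comment> \<open>Extension by zero makes the coefficients comparable with those over
    \<open>\<Delta>\<close>, where their common sign is known.\<close>
  have c': "u \<beta> = lin_comb \<Delta> (\<lambda>\<gamma>. if \<gamma> \<in> J then c \<gamma> else 0)"
    unfolding c lin_comb_def using finite_simple assms(1)
    by (auto simp: if_distrib[where f="\<lambda>x. x * _"] sum.If_cases Int_absorb1 cong: if_cong)
  have ruc: "r (u \<beta>) = (\<lambda>i. \<Sum>\<gamma>\<in>J. c \<gamma> * r \<gamma> i)"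
    unfolding c by (rule linear_fun_lin_comb[OF coxeter_group_linear[OF assms(2)] f])
  show ?thesis
  proof (cases "pos (u \<beta>)")
    case True
    have "c \<gamma> \<ge> 0" if "\<gamma> \<in> J" for \<gamma>
      using pos_root_coeffs[OF ub c' _ True, of \<gamma>] that assms(1) by auto
    then have "pos (r (u \<beta>))" unfolding ruc using assms(3) f by (intro pos_sum) auto
    with True show ?thesis by simp
  next
    case False
    have "c \<gamma> \<le> 0" if "\<gamma> \<in> J" for \<gamma>
      using neg_root_coeffs[OF ub c' _ False, of \<gamma>] that assms(1) by auto
    then have "pos (\<lambda>i. \<Sum>\<gamma>\<in>J. (- c \<gamma>) * r \<gamma> i)" using assms(3) f by (intro pos_sum) auto
    then have "pos (\<lambda>i. - r (u \<beta>) i)" unfolding ruc by (simp add: sum_negf)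
    with False show ?thesis using pos_uminus_root[OF W_root[OF assms(2) ub]] by simp
  qed
qed

text \<open>Reparametrising the coset by \<open>w \<circ> u0\<close>, which is positive on
  \<open>J\<close>, turns the signs on \<open>J\<close> into those of the parabolic subgroup itself,
  whatever \<open>w\<close> is.\<close>

lemma sum_parabolic_coset:
  fixes f :: "(vec \<Rightarrow> vec) \<Rightarrow> 'b::comm_monoid_add"
  assumes "J \<subseteq> \<Delta>" "descent_determined J f" "w \<in> W"
  shows "(\<Sum>u\<in>coxeter_group d J. f (w \<circ> u)) = (\<Sum>u\<in>coxeter_group d J. f u)"
proof -
  let ?G = "coxeter_group d J"
  obtain u0 where u0: "u0 \<in> ?G" "\<forall>\<beta>\<in>J. pos (w (u0 \<beta>))"
    using parabolic_coset_rep[OF assms(1,3)] by blast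
  have nz: "\<And>\<alpha>. \<alpha> \<in> J \<Longrightarrow> ip d \<alpha> \<alpha> \<noteq> 0"
    using assms(1) simple_root root_ip_nonzero by blast
  have r: "w \<circ> u0 \<in> W"
    using assms(1,3) u0(1) parabolic_subset coxeter_group_mult by blast
  have "(\<Sum>u\<in>?G. f (w \<circ> u)) = (\<Sum>u\<in>?G. f (w \<circ> (u0 \<circ> u)))"
    by (rule sum.reindex_bij_betw[OF coxeter_group_left_mult_bij[OF nz u0(1)], symmetric])
  also have "\<dots> = (\<Sum>u\<in>?G. f u)"
  proof (rule sum.cong[OF HOL.refl])
    fix u assume u: "u \<in> ?G"
    then have "u \<in> W" using assms(1) parabolic_subset by blast
    show "f (w \<circ> (u0 \<circ> u)) = f u"
      by (rule descent_determinedD[OF assms(2)])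
        (use pos_parabolic[OF assms(1) r _ u] u0 \<open>u \<in> W\<close> coxeter_group_mult[OF r \<open>u \<in> W\<close>]
         in \<open>auto simp: comp_assoc\<close>)
  qed
  finally show ?thesis .
qed

lemma sum_W_shift:
  assumes "u \<in> W" shows "(\<Sum>w\<in>W. f (w \<circ> u)) = (\<Sum>w\<in>W. f w)"
  by (rule sum.reindex_bij_betw[OF coxeter_group_right_mult_bij[OF root_ip_nonzero assms]])

abbreviation mean :: "((vec \<Rightarrow> vec) \<Rightarrow> 'b::{banach, second_countable_topology}) \<Rightarrow> 'b" where
  "mean f \<equiv> measure_pmf.expectation (pmf_of_set W) f"

lemma mean_eq: "mean f = (\<Sum>w\<in>W. f w) /\<^sub>R real (card W)"
  by (subst integral_measure_pmf[of W]) (simp_all add: finite_W W_nonempty scaleR_sum_right inverse_eq_divide)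

lemma mean_shift: "u \<in> W \<Longrightarrow> mean (\<lambda>w. f (w \<circ> u)) = mean f"
  by (simp add: mean_eq sum_W_shift[of u f])

text \<open>The double sum of \<open>f (w \<circ> u)\<close> is evaluated in both orders: over
  \<open>u\<close> by the coset lemma, over \<open>w\<close> by translation invariance.\<close>

lemma mean_parabolic:
  fixes f :: "(vec \<Rightarrow> vec) \<Rightarrow> 'b::{banach, second_countable_topology}"
  assumes "J \<subseteq> \<Delta>" "descent_determined J f"
  shows "mean f = (\<Sum>u\<in>coxeter_group d J. f u) /\<^sub>R real (card (coxeter_group d J))"
proof -
  let ?G = "coxeter_group d J"
  have G: "?G \<subseteq> W" "finite ?G" "?G \<noteq> {}"
    using parabolic_subset finite_parabolic parabolic_nonempty assms(1) by simp_all
  have "real (card W) *\<^sub>R (\<Sum>u\<in>?G. f u) = (\<Sum>w\<in>W. \<Sum>u\<in>?G. f (w \<circ> u))"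
    using sum_parabolic_coset[OF assms] by (simp add: scaleR_conv_of_real sum_constant_scaleR)
  also have "\<dots> = (\<Sum>u\<in>?G. \<Sum>w\<in>W. f (w \<circ> u))" by (rule sum.swap)
  also have "\<dots> = real (card ?G) *\<^sub>R (\<Sum>w\<in>W. f w)"
    using sum_W_shift[of _ f] G(1) by (simp add: sum_constant_scaleR subset_iff)
  finally have e: "real (card W) *\<^sub>R (\<Sum>u\<in>?G. f u) = real (card ?G) *\<^sub>R (\<Sum>w\<in>W. f w)" .
  have "card ?G > 0" using G by (simp add: card_gt_0_iff)
  then show ?thesis
    unfolding mean_eq using card_W_pos by (intro scaleR_cross_eq[OF _ _ e]) auto
qed

text \<open>Averaging runs over pairs \<open>(u, v)\<close> from the two parabolic subgroups. By
  orthogonality \<open>f\<close> does not see \<open>v\<close> and \<open>g\<close> does not see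
  \<open>u\<close>, so the double sum over a translate factors into two coset sums, neither
  depending on \<open>w\<close>.\<close>

lemma mean_mult_orthogonal:
  fixes f g :: "(vec \<Rightarrow> vec) \<Rightarrow> 'b::{real_normed_field, banach, second_countable_topology}"
  assumes J: "J \<subseteq> \<Delta>" "descent_determined J f" and K: "K \<subseteq> \<Delta>" "descent_determined K g"
    and ortho: "\<And>\<beta> \<gamma>. \<beta> \<in> J \<Longrightarrow> \<gamma> \<in> K \<Longrightarrow> ip d \<beta> \<gamma> = 0"
  shows "mean (\<lambda>w. f w * g w) = mean f * mean g"
proof -
  let ?G = "coxeter_group d J" and ?H = "coxeter_group d K"
  have G: "?G \<subseteq> W" "finite ?G" "?G \<noteq> {}"
    using parabolic_subset finite_parabolic parabolic_nonempty J(1) by simp_all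
  have H: "?H \<subseteq> W" "finite ?H" "?H \<noteq> {}"
    using parabolic_subset finite_parabolic parabolic_nonempty K(1) by simp_all
  have f: "f (w \<circ> (u \<circ> v)) = f (w \<circ> u)" if "w \<in> W" "u \<in> ?G" "v \<in> ?H" for w u v
  proof (rule descent_determinedD[OF J(2)])
    show "w \<circ> (u \<circ> v) \<in> W" "w \<circ> u \<in> W" using that G(1) H(1) coxeter_group_mult by (metis subsetD)+
    fix \<beta> assume "\<beta> \<in> J"
    then have "v \<beta> = \<beta>" using coxeter_group_fixes_orthogonal[OF that(3)] ortho by blast
    then show "pos ((w \<circ> (u \<circ> v)) \<beta>) = pos ((w \<circ> u) \<beta>)" by simp
  qed
  have g: "g (w \<circ> (u \<circ> v)) = g (w \<circ> v)" if "w \<in> W" "u \<in> ?G" "v \<in> ?H" for w u v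
  proof (rule descent_determinedD[OF K(2)])
    show "w \<circ> (u \<circ> v) \<in> W" "w \<circ> v \<in> W" using that G(1) H(1) coxeter_group_mult by (metis subsetD)+
    fix \<beta> assume b: "\<beta> \<in> K"
    \<comment> \<open>\<open>v\<close> is an isometry fixing \<open>J\<close> pointwise, so
      \<open>v \<beta>\<close> is still orthogonal to \<open>J\<close> and is therefore fixed by
      \<open>u\<close>.\<close>
    have "ip d (v \<beta>) \<alpha> = 0" if "\<alpha> \<in> J" for \<alpha>
    proof -
      have "v \<alpha> = \<alpha>" using coxeter_group_fixes_orthogonal[OF \<open>v \<in> ?H\<close>] ortho that by blast
      then have "ip d (v \<beta>) \<alpha> = ip d \<beta> \<alpha>"
        using ip_coxeter_group[OF root_ip_nonzero, where w = v and u = \<beta> and v = \<alpha>] \<open>v \<in> ?H\<close> H(1) by auto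
      then show ?thesis using ortho[OF that b] by (simp add: ip_commute)
    qed
    then have "u (v \<beta>) = v \<beta>" using coxeter_group_fixes_orthogonal[OF \<open>u \<in> ?G\<close>] by blast
    then show "pos ((w \<circ> (u \<circ> v)) \<beta>) = pos ((w \<circ> v) \<beta>)" by simp
  qed
  define h where "h w = f w * g w" for w
  let ?F = "\<Sum>u\<in>?G. f u" and ?L = "\<Sum>v\<in>?H. g v"
  have "real (card ?G * card ?H) *\<^sub>R (\<Sum>w\<in>W. h w) = (\<Sum>u\<in>?G. \<Sum>v\<in>?H. \<Sum>w\<in>W. h (w \<circ> (u \<circ> v)))"
  proof -
    have "(\<Sum>w\<in>W. h (w \<circ> (u \<circ> v))) = (\<Sum>w\<in>W. h w)" if "u \<in> ?G" "v \<in> ?H" for u v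
      using that G(1) H(1) by (intro sum_W_shift coxeter_group_mult) auto
    then show ?thesis by (simp add: scaleR_conv_of_real)
  qed
  also have "\<dots> = (\<Sum>u\<in>?G. \<Sum>w\<in>W. \<Sum>v\<in>?H. h (w \<circ> (u \<circ> v)))"
    by (rule sum.cong[OF HOL.refl]) (rule sum.swap)
  also have "\<dots> = (\<Sum>w\<in>W. \<Sum>u\<in>?G. \<Sum>v\<in>?H. h (w \<circ> (u \<circ> v)))"
    by (rule sum.swap)
  also have "\<dots> = (\<Sum>w\<in>W. \<Sum>u\<in>?G. \<Sum>v\<in>?H. f (w \<circ> u) * g (w \<circ> v))"
    by (intro sum.cong HOL.refl) (simp add: h_def[abs_def] f g)
  also have "\<dots> = (\<Sum>w\<in>W. (\<Sum>u\<in>?G. f (w \<circ> u)) * (\<Sum>v\<in>?H. g (w \<circ> v)))"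
    by (simp add: sum_product)
  also have "\<dots> = real (card W) *\<^sub>R (?F * ?L)"
    by (simp add: sum_parabolic_coset[OF J] sum_parabolic_coset[OF K] scaleR_conv_of_real)
  finally have e: "real (card ?G * card ?H) *\<^sub>R (\<Sum>w\<in>W. h w) = real (card W) *\<^sub>R (?F * ?L)" .
  have c: "card ?G > 0" "card ?H > 0" using G H by (auto simp: card_gt_0_iff)
  have "mean h = (?F * ?L) /\<^sub>R (real (card ?G * card ?H))"
    unfolding mean_eq using c card_W_pos by (intro scaleR_cross_eq[OF _ _ e[symmetric]]) auto
  also have "\<dots> = mean f * mean g"
    unfolding mean_parabolic[OF J] mean_parabolic[OF K] by simp
  finally show ?thesis by (simp add: h_def[abs_def])
qed

end

section \<open>Rank two\<close>

context simple_roots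
begin

definition nrm :: "vec \<Rightarrow> real" where "nrm v = sqrt (ip d v v)"

definition unit :: "vec \<Rightarrow> vec" where "unit v = (\<lambda>i. (1 / nrm v) * v i)"

text \<open>The sign is chosen because simple roots meet at the angle \<open>pi - pi / m\<close>;
  with it the value becomes \<open>cos (pi / m)\<close>, where \<open>m\<close> is the edge
  label.\<close>

definition cosang :: "vec \<Rightarrow> vec \<Rightarrow> real" where
  "cosang u v = - ip d (unit u) (unit v)"

definition agree :: "vec \<Rightarrow> vec \<Rightarrow> real" where
  "agree \<beta> \<gamma> = mean (\<lambda>w. of_bool (pos (w \<beta>) = pos (w \<gamma>)))"

lemma nrm_pos: "\<alpha> \<in> \<Phi> \<Longrightarrow> nrm \<alpha> > 0"
  using root_ip_pos by (simp add: nrm_def)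

lemma nrm_square: "nrm v * nrm v = ip d v v"
  by (simp add: nrm_def ip_nonneg)

lemma scale_unit: "\<alpha> \<in> \<Phi> \<Longrightarrow> \<alpha> = (\<lambda>i. nrm \<alpha> * unit \<alpha> i)"
  using nrm_pos[of \<alpha>] by (simp add: unit_def)

lemma ip_unit_self: "\<alpha> \<in> \<Phi> \<Longrightarrow> ip d (unit \<alpha>) (unit \<alpha>) = 1"
  using nrm_pos[of \<alpha>] unfolding unit_def ip_scale_left ip_scale_right
  by (simp add: nrm_square[symmetric])

lemma cosang_commute: "cosang u v = cosang v u"
  by (simp add: cosang_def ip_commute)

lemma cosang_eq: "cosang u v = - ip d u v / (nrm u * nrm v)"
  unfolding cosang_def unit_def ip_scale_left ip_scale_right by simp

lemma cosang_nonneg: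
  "\<beta> \<in> \<Delta> \<Longrightarrow> \<gamma> \<in> \<Delta> \<Longrightarrow> \<beta> \<noteq> \<gamma> \<Longrightarrow> cosang \<beta> \<gamma> \<ge> 0"
  using ip_simple_nonpos nrm_pos[OF simple_root] unfolding cosang_eq
  by (intro divide_nonneg_pos mult_pos_pos) auto

lemma cosang_eq_0_iff: "\<beta> \<in> \<Phi> \<Longrightarrow> \<gamma> \<in> \<Phi> \<Longrightarrow> cosang \<beta> \<gamma> = 0 \<longleftrightarrow> ip d \<beta> \<gamma> = 0"
  using nrm_pos unfolding cosang_eq by force

lemma pos_unit: "\<alpha> \<in> \<Phi> \<Longrightarrow> w \<in> W \<Longrightarrow> pos (w (unit \<alpha>)) \<longleftrightarrow> pos (w \<alpha>)"
proof -
  assume a: "\<alpha> \<in> \<Phi>" "w \<in> W"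
  have "w (unit \<alpha>) = (\<lambda>i. (1 / nrm \<alpha>) * w \<alpha> i)"
    unfolding unit_def by (rule linear_fun_scale[OF coxeter_group_linear[OF a(2)]])
  then show ?thesis using pos_scale[of "1 / nrm \<alpha>" "w \<alpha>"] nrm_pos[OF a(1)] by simp
qed

lemma pos_uminus_unit:
  "\<alpha> \<in> \<Phi> \<Longrightarrow> w \<in> W \<Longrightarrow> pos (\<lambda>i. - w (unit \<alpha>) i) \<longleftrightarrow> \<not> pos (w \<alpha>)"
proof -
  assume a: "\<alpha> \<in> \<Phi>" "w \<in> W"
  have l: "linear_fun w" using a(2) by (rule coxeter_group_linear)
  have "w (unit (\<lambda>i. - \<alpha> i)) = (\<lambda>i. - w (unit \<alpha>) i)"
    using linear_fun_scale[OF l, of "- (1 / nrm \<alpha>)" \<alpha>] linear_fun_scale[OF l, of "1 / nrm \<alpha>" \<alpha>]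
    by (simp add: unit_def nrm_def ip_def)
  then show ?thesis
    using pos_unit[OF root_uminus[OF a(1)] a(2)] pos_uminus_root[OF W_root[OF a(2,1)]]
      linear_fun_minus[OF l, of \<alpha>] by simp
qed

lemma refl_unit_self: "\<alpha> \<in> \<Phi> \<Longrightarrow> refl d \<alpha> (unit \<alpha>) = (\<lambda>i. - unit \<alpha> i)"
  unfolding unit_def
  using linear_fun_scale[OF linear_fun_refl, of d \<alpha> "1 / nrm \<alpha>" \<alpha>] refl_self[OF root_ip_nonzero]
  by simp

lemma refl_unit:
  assumes "\<alpha> \<in> \<Phi>"
  shows "refl d \<alpha> (unit v) = (\<lambda>i. 1 * unit v i + (2 * cosang \<alpha> v) * unit \<alpha> i)"
proof
  fix i
  have "2 * ip d (unit v) \<alpha> / ip d \<alpha> \<alpha> * \<alpha> i = - (2 * cosang \<alpha> v) * unit \<alpha> i"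
    using nrm_pos[OF assms] unfolding cosang_def unit_def ip_scale_left ip_scale_right
    by (simp add: nrm_square[symmetric] ip_commute field_simps)
  then show "refl d \<alpha> (unit v) i = 1 * unit v i + (2 * cosang \<alpha> v) * unit \<alpha> i"
    by (simp add: refl_def)
qed

text \<open>Otherwise the sum of the two unit vectors has squared norm
  \<open>2 - 2 * cosang \<beta> \<gamma> \<le> 0\<close>, making them opposite although both are
  positive.\<close>

lemma cosang_less_1:
  assumes "\<beta> \<in> \<Delta>" "\<gamma> \<in> \<Delta>" "\<beta> \<noteq> \<gamma>"
  shows "cosang \<beta> \<gamma> < 1"
proof (rule ccontr)
  assume n: "\<not> cosang \<beta> \<gamma> < 1"
  have r: "\<beta> \<in> \<Phi>" "\<gamma> \<in> \<Phi>" using assms simple_root by auto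
  let ?x = "\<lambda>i. 1 * unit \<beta> i + 1 * unit \<gamma> i"
  have "ip d ?x ?x = ip d (unit \<beta>) ?x + ip d (unit \<gamma>) ?x"
    using ip_comb_left[of d 1 "unit \<beta>" 1 "unit \<gamma>" ?x] by simp
  also have "\<dots> = 2 - 2 * cosang \<beta> \<gamma>"
    unfolding ip_commute[of d _ ?x] ip_comb_left using ip_unit_self r
    by (simp add: cosang_def ip_commute)
  finally have "ip d ?x ?x = 0" using n ip_nonneg[of d ?x] by simp
  moreover have "?x \<in> vspace d" using root_vspace[OF r(1)] root_vspace[OF r(2)]
    by (auto simp: vspace_def unit_def)
  ultimately have x: "?x = (\<lambda>_. 0)" by (intro ip_self_eq_0)
  have p: "pos (unit \<beta>)" "pos (unit \<gamma>)"
    using pos_unit[OF _ coxeter_group.id] r pos_simple assms by auto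
  have "unit \<gamma> = (\<lambda>i. - unit \<beta> i)"
    using fun_cong[OF x] by (auto simp: fun_eq_iff add_eq_0_iff)
  then have "unit \<beta> = (\<lambda>_. 0)" using pos_antisym p by metis
  then show False using ip_unit_self[OF r(1)] by (simp add: ip_def)
qed

text \<open>These are also the coefficients over \<open>\<Delta>\<close>, so they cannot have mixed
  signs; the product covers positive and negative roots at once.\<close>

lemma root_two_coeffs:
  assumes "\<beta> \<in> \<Delta>" "\<gamma> \<in> \<Delta>" "\<beta> \<noteq> \<gamma>" "\<alpha> \<in> \<Phi>" "\<alpha> = (\<lambda>i. x * \<beta> i + y * \<gamma> i)"
  shows "x * y \<ge> 0"
proof -
  let ?c = "\<lambda>\<delta>. x * (if \<delta> = \<beta> then 1 else 0) + y * (if \<delta> = \<gamma> then 1 else 0)"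
  have c: "\<alpha> = lin_comb \<Delta> ?c"
  proof
    fix i
    have "lin_comb \<Delta> ?c i = x * lin_comb \<Delta> (\<lambda>\<delta>. if \<delta> = \<beta> then 1 else 0) i
        + y * lin_comb \<Delta> (\<lambda>\<delta>. if \<delta> = \<gamma> then 1 else 0) i"
      by (simp only: lin_comb_def distrib_right sum.distrib sum_distrib_left mult.assoc)
    then show "\<alpha> i = lin_comb \<Delta> ?c i"
      using simple_lin_comb[OF assms(1)] simple_lin_comb[OF assms(2)] assms(5) by simp
  qed
  show ?thesis
  proof (cases "pos \<alpha>")
    case True
    then have "x \<ge> 0" "y \<ge> 0"
      using pos_root_coeffs[OF assms(4) c assms(1)] pos_root_coeffs[OF assms(4) c assms(2)] assms(3)
      by auto
    then show ?thesis by simp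
  next
    case False
    then have "x \<le> 0" "y \<le> 0"
      using neg_root_coeffs[OF assms(4) c assms(1)] neg_root_coeffs[OF assms(4) c assms(2)] assms(3)
      by auto
    then show ?thesis by (simp add: mult_nonpos_nonpos)
  qed
qed

lemma agree_commute: "agree \<beta> \<gamma> = agree \<gamma> \<beta>"
  unfolding agree_def by (simp only: eq_commute[of "pos (_ \<beta>)"])

lemma agree_shift:
  "u \<in> W \<Longrightarrow> mean (\<lambda>w. of_bool (pos (w (u \<beta>)) = pos (w (u \<gamma>)))) = agree \<beta> \<gamma>"
  using mean_shift[of u "\<lambda>w. of_bool (pos (w \<beta>) = pos (w \<gamma>)) :: real"] by (simp add: agree_def)

lemma mean_cong:
  fixes f g :: "(vec \<Rightarrow> vec) \<Rightarrow> 'b::{banach, second_countable_topology}"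
  shows "(\<And>w. w \<in> W \<Longrightarrow> f w = g w) \<Longrightarrow> mean f = mean g"
  by (simp add: mean_eq)

lemma mean_mono:
  fixes f g :: "(vec \<Rightarrow> vec) \<Rightarrow> real"
  shows "(\<And>w. w \<in> W \<Longrightarrow> f w \<le> g w) \<Longrightarrow> mean f \<le> mean g"
  unfolding mean_eq by (intro scaleR_left_mono sum_mono) auto

lemma integrable_W:
  fixes f :: "(vec \<Rightarrow> vec) \<Rightarrow> 'b::{banach, second_countable_topology}"
  shows "integrable (measure_pmf (pmf_of_set W)) f"
  by (rule integrable_measure_pmf_finite) (simp add: finite_W W_nonempty)

text \<open>
  The roots in the plane of \<open>\<beta>\<close> and \<open>\<gamma>\<close> that are reached by alternating the two
  simple reflections have directions \<open>v 0 = - unit \<gamma>\<close>, \<open>v 1 = unit \<beta>\<close>, \<open>v 2\<close>, and so on, each turned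
  by the angle \<open>\<theta>\<close> with cosine \<open>cosang \<beta> \<gamma>\<close> against its predecessor.  None of them has coefficients
  of mixed sign, so \<open>\<theta>\<close> divides \<open>pi\<close>.  Each pair of neighbours is, up to a sign, an image of
  \<open>(unit \<beta>, unit \<gamma>)\<close>, and between \<open>- unit \<gamma>\<close> and \<open>unit \<gamma>\<close> the sign of \<open>w\<close> changes somewhere.\<close>

lemma rank_two:
  assumes \<beta>: "\<beta> \<in> \<Delta>" and \<gamma>: "\<gamma> \<in> \<Delta>" and "\<beta> \<noteq> \<gamma>"
  shows "\<exists>m\<ge>2. cosang \<beta> \<gamma> = cos (pi / real m) \<and> 1 \<le> real m * agree \<beta> \<gamma>"
proof -
  have r: "\<beta> \<in> \<Phi>" "\<gamma> \<in> \<Phi>" using assms simple_root by auto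
  define c where "c = cosang \<beta> \<gamma>"
  define \<theta> where "\<theta> = arccos c"
  have c: "0 \<le> c" "c < 1" using cosang_nonneg cosang_less_1 assms by (auto simp: c_def)
  have cos: "cos \<theta> = c" using c by (simp add: \<theta>_def)
  have \<theta>: "0 < \<theta>" "\<theta> \<le> pi / 2"
    using c arccos_less_arccos[of c 1] arccos_le_arccos[of 0 c] by (auto simp: \<theta>_def)
  have \<theta>pi: "\<theta> < pi" using \<theta> pi_gt_zero by linarith
  have s: "sin \<theta> > 0" using \<theta>(1) \<theta>pi by (rule sin_gt_zero)
  \<comment> \<open>The unit vector at angle \<open>j * \<theta>\<close> from
    \<open>- unit \<gamma>\<close>, written in the basis \<open>unit \<beta>\<close>,
    \<open>unit \<gamma>\<close>.\<close>
  define v where "v j = (\<lambda>i. (sin (real j * \<theta>) / sin \<theta>) * unit \<beta> i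
      + (sin ((real j - 1) * \<theta>) / sin \<theta>) * unit \<gamma> i)" for j :: nat
  have rec: "v (Suc (Suc j)) = (\<lambda>i. 2 * c * v (Suc j) i - v j i)" for j
  proof
    fix i
    have e: "sin (x + \<theta>) = 2 * c * sin x - sin (x - \<theta>)" for x
      by (simp add: sin_add sin_diff cos)
    have "sin (real (Suc (Suc j)) * \<theta>) = 2 * c * sin (real (Suc j) * \<theta>) - sin (real j * \<theta>)"
      using e[of "real (Suc j) * \<theta>"] by (simp add: algebra_simps)
    moreover have "sin ((real (Suc (Suc j)) - 1) * \<theta>)
        = 2 * c * sin ((real (Suc j) - 1) * \<theta>) - sin ((real j - 1) * \<theta>)"
      using e[of "real j * \<theta>"] by (simp add: algebra_simps)
    ultimately show "v (Suc (Suc j)) i = 2 * c * v (Suc j) i - v j i"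
      unfolding v_def by (simp only: diff_divide_distrib left_diff_distrib) (simp add: algebra_simps)
  qed
  have v0: "v 0 = (\<lambda>i. - unit \<gamma> i)" and v1: "v (Suc 0) = unit \<beta>"
    using s by (auto simp: v_def)
  \<comment> \<open>Each step composes with the simple reflection whose unit vector currently maps
    to \<open>v (Suc j)\<close>; this swaps the roles of \<open>\<beta>\<close> and
    \<open>\<gamma>\<close>, hence the disjunction.\<close>
  have chain: "\<exists>u\<in>W. (u (unit \<beta>) = v (Suc j) \<and> u (unit \<gamma>) = (\<lambda>i. - v j i)) \<or>
      (u (unit \<gamma>) = v (Suc j) \<and> u (unit \<beta>) = (\<lambda>i. - v j i))" for j
  proof (induction j)
    case 0
    show ?case by (rule bexI[OF _ coxeter_group.id]) (simp add: v0 v1)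
  next
    case (Suc j)
    have step: "\<exists>u'\<in>W. u' (unit x) = (\<lambda>i. - v (Suc j) i) \<and> u' (unit y) = v (Suc (Suc j))"
      if u: "u \<in> W" and e: "u (unit x) = v (Suc j)" "u (unit y) = (\<lambda>i. - v j i)"
        and x: "x \<in> \<Phi>" and cx: "cosang x y = c" for u x y
    proof (rule bexI)
      have l: "linear_fun u" by (rule coxeter_group_linear[OF u])
      have "u (refl d x (unit x)) = (\<lambda>i. - v (Suc j) i)"
        unfolding refl_unit_self[OF x] linear_fun_minus[OF l] e ..
      moreover have "u (refl d x (unit y)) = v (Suc (Suc j))"
        unfolding refl_unit[OF x] linear_fun_comb[OF l] e rec cx by (auto simp: algebra_simps)
      ultimately show "(u \<circ> refl d x) (unit x) = (\<lambda>i. - v (Suc j) i) \<and>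
          (u \<circ> refl d x) (unit y) = v (Suc (Suc j))" by simp
      show "u \<circ> refl d x \<in> W" by (rule coxeter_group_mult[OF u coxeter_group_refl[OF x]])
    qed
    from Suc obtain u where u: "u \<in> W" "(u (unit \<beta>) = v (Suc j) \<and> u (unit \<gamma>) = (\<lambda>i. - v j i)) \<or>
      (u (unit \<gamma>) = v (Suc j) \<and> u (unit \<beta>) = (\<lambda>i. - v j i))" by blast
    from u(2) show ?case
    proof
      assume "u (unit \<beta>) = v (Suc j) \<and> u (unit \<gamma>) = (\<lambda>i. - v j i)"
      then show ?thesis using step[OF u(1), of \<beta> \<gamma>] r by (auto simp: c_def)
    next
      assume "u (unit \<gamma>) = v (Suc j) \<and> u (unit \<beta>) = (\<lambda>i. - v j i)"
      then show ?thesis using step[OF u(1), of \<gamma> \<beta>] r by (auto simp: c_def cosang_commute)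
    qed
  qed
  have same_sign: "sin (real (Suc j) * \<theta>) * sin (real j * \<theta>) \<ge> 0" for j
  proof -
    obtain u where u: "u \<in> W" "u (unit \<beta>) = v (Suc j) \<or> u (unit \<gamma>) = v (Suc j)"
      using chain by blast
    then obtain x where x: "x \<in> \<Phi>" "u (unit x) = v (Suc j)" using r by blast
    have ux: "u x = (\<lambda>i. nrm x * v (Suc j) i)"
      using linear_fun_scale[OF coxeter_group_linear[OF u(1)], of "nrm x" "unit x"]
        scale_unit[OF x(1)] x(2) by simp
    let ?k = "nrm x * sin (real (Suc j) * \<theta>) / sin \<theta> / nrm \<beta>"
    let ?l = "nrm x * sin (real j * \<theta>) / sin \<theta> / nrm \<gamma>"
    have "u x = (\<lambda>i. ?k * \<beta> i + ?l * \<gamma> i)"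
      unfolding ux v_def unit_def by (auto simp: algebra_simps)
    then have "?k * ?l \<ge> 0" by (rule root_two_coeffs[OF assms W_root[OF u(1) x(1)]])
    moreover have "?k * ?l = (sin (real (Suc j) * \<theta>) * sin (real j * \<theta>))
        * (nrm x * nrm x / (sin \<theta> * sin \<theta> * nrm \<beta> * nrm \<gamma>))"
      by (simp only: times_divide_eq_right times_divide_eq_left divide_divide_eq_left mult_ac)
    moreover have pos_pm: "nrm x * nrm x / (sin \<theta> * sin \<theta> * nrm \<beta> * nrm \<gamma>) > 0"
      using nrm_pos x(1) r s by simp
    ultimately have "(sin (real (Suc j) * \<theta>) * sin (real j * \<theta>))
        * (nrm x * nrm x / (sin \<theta> * sin \<theta> * nrm \<beta> * nrm \<gamma>)) \<ge> 0" by (simp only:)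
    then show ?thesis using pos_pm by (simp only: zero_le_mult_iff) linarith
  qed
  define m where "m = (LEAST m. pi \<le> real m * \<theta>)"
  have ex: "\<exists>m. pi \<le> real m * \<theta>"
    using reals_Archimedean3[OF \<theta>(1)] less_imp_le by blast
  have m: "pi \<le> real m * \<theta>" unfolding m_def using ex by (rule LeastI_ex)
  have "m \<noteq> 0" using m pi_gt_zero by (metis mult_zero_left not_less of_nat_0)
  then obtain k where k: "m = Suc k" by (cases m) auto
  have km: "real k * \<theta> < pi" using not_less_Least[of k "\<lambda>m. pi \<le> real m * \<theta>"] k m_def by auto
  have "k \<noteq> 0"
  proof
    assume "k = 0"
    then have "real m = 1" using k by simp
    then have "pi \<le> \<theta>" using m by (metis mult_1)
    then show False using \<theta>pi by linarith
  qed
  then have "sin (real k * \<theta>) > 0" using km \<theta> by (intro sin_gt_zero) auto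
  with same_sign[of k] have "sin (real m * \<theta>) \<ge> 0"
    unfolding k by (simp add: zero_le_mult_iff)
  \<comment> \<open>Overshooting would put \<open>m * \<theta>\<close> strictly between
    \<open>pi\<close> and \<open>2 * pi\<close>, against the nonnegative sine just obtained from
    \<open>same_sign\<close>.\<close>
  moreover have "sin (real m * \<theta>) < 0" if "real m * \<theta> \<noteq> pi"
  proof -
    have "real m * \<theta> - pi < pi" using km \<theta>pi by (simp add: k algebra_simps)
    then have "sin (real m * \<theta> - pi) > 0" using that m by (intro sin_gt_zero) auto
    then show ?thesis by simp
  qed
  ultimately have mpi: "real m * \<theta> = pi" by fastforce
  then have \<theta>m: "\<theta> = pi / real m" using \<open>m \<noteq> 0\<close> by (simp add: field_simps)
  have "(real m - 1) * \<theta> = pi - \<theta>" using mpi by (simp add: algebra_simps)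
  then have vm: "v m = unit \<gamma>" using s by (simp add: v_def mpi)
  have neigh: "mean (\<lambda>w. of_bool (pos (w (v (Suc j))) \<noteq> pos (w (v j))) :: real) = agree \<beta> \<gamma>" for j
  proof -
    have *: "mean (\<lambda>w. of_bool (pos (w (v (Suc j))) \<noteq> pos (w (v j))) :: real) = agree x y"
      if u: "u \<in> W" and e: "u (unit x) = v (Suc j)" "u (unit y) = (\<lambda>i. - v j i)"
        and x: "x \<in> \<Phi>" "y \<in> \<Phi>" for u x y
    proof -
      have l: "linear_fun u" by (rule coxeter_group_linear[OF u])
      have "mean (\<lambda>w. of_bool (pos (w (v (Suc j))) \<noteq> pos (w (v j))) :: real)
        = mean (\<lambda>w. of_bool (pos (w (u x)) = pos (w (u y))))"
      proof (rule mean_cong)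
        fix w assume w: "w \<in> W"
        then have wu: "w \<circ> u \<in> W" using u by (rule coxeter_group_mult)
        have "pos (w (v (Suc j))) \<longleftrightarrow> pos (w (u x))"
          using pos_unit[OF x(1) wu] e(1) by simp
        moreover have "v j = (\<lambda>i. - u (unit y) i)" using e(2) by simp
        then have "pos (w (v j)) \<longleftrightarrow> \<not> pos (w (u y))"
          using pos_uminus_unit[OF x(2) wu] linear_fun_minus[OF coxeter_group_linear[OF w], of "u (unit y)"]
          by simp
        ultimately show "(of_bool (pos (w (v (Suc j))) \<noteq> pos (w (v j))) :: real)
          = of_bool (pos (w (u x)) = pos (w (u y)))" by simp
      qed
      also have "\<dots> = agree x y" by (rule agree_shift[OF u])
      finally show ?thesis .
    qed
    from chain[of j] obtain u where u: "u \<in> W" "(u (unit \<beta>) = v (Suc j) \<and> u (unit \<gamma>) = (\<lambda>i. - v j i)) \<or>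
      (u (unit \<gamma>) = v (Suc j) \<and> u (unit \<beta>) = (\<lambda>i. - v j i))" by blast
    from u(2) show ?thesis
    proof
      assume "u (unit \<beta>) = v (Suc j) \<and> u (unit \<gamma>) = (\<lambda>i. - v j i)"
      then show ?thesis using *[OF u(1) _ _ r] by blast
    next
      assume "u (unit \<gamma>) = v (Suc j) \<and> u (unit \<beta>) = (\<lambda>i. - v j i)"
      then show ?thesis using *[OF u(1) _ _ r(2,1)] agree_commute[of \<gamma> \<beta>] by simp
    qed
  qed
  have "1 = mean (\<lambda>w. 1 :: real)" by simp
  also have "\<dots> \<le> mean (\<lambda>w. \<Sum>j<m. of_bool (pos (w (v (Suc j))) \<noteq> pos (w (v j))))"
  proof (rule mean_mono)
    fix w assume w: "w \<in> W"
    have "pos (w (v 0)) \<longleftrightarrow> \<not> pos (w (v m))"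
      unfolding v0 vm linear_fun_minus[OF coxeter_group_linear[OF w]]
      using pos_uminus_unit[OF r(2) w] pos_unit[OF r(2) w] by simp
    \<comment> \<open>The signs at the two ends differ, so some neighbouring pair differs. Summing
      the \<open>m\<close> equal probabilities then gives the lower bound on
      \<open>agree\<close>.\<close>
    then have "\<exists>j<m. pos (w (v (Suc j))) \<noteq> pos (w (v j))"
      using inc_induct[of 0 m "\<lambda>j. pos (w (v j)) = pos (w (v m))"] by auto
    then obtain j where j: "j < m" "pos (w (v (Suc j))) \<noteq> pos (w (v j))" by blast
    have "(\<Sum>j<m. of_bool (pos (w (v (Suc j))) \<noteq> pos (w (v j))) :: real)
        \<ge> of_bool (pos (w (v (Suc j))) \<noteq> pos (w (v j)))"
      using j(1) by (intro member_le_sum) auto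
    then show "1 \<le> (\<Sum>j<m. of_bool (pos (w (v (Suc j))) \<noteq> pos (w (v j))) :: real)"
      using j(2) by simp
  qed
  also have "\<dots> = (\<Sum>j<m. mean (\<lambda>w. of_bool (pos (w (v (Suc j))) \<noteq> pos (w (v j)))))"
    by (rule Bochner_Integration.integral_sum) (rule integrable_W)
  also have "\<dots> = real m * agree \<beta> \<gamma>"
    by (simp only: neigh sum_constant card_lessThan)
  finally have "1 \<le> real m * agree \<beta> \<gamma>" .
  moreover have "m \<ge> 2" using k \<open>k \<noteq> 0\<close> by simp
  moreover have "cosang \<beta> \<gamma> = cos (pi / real m)" using cos \<theta>m c_def by simp
  ultimately show ?thesis by blast
qed

end

section \<open>The variance and the dependency graph of the descents\<close>

text \<open>The left side is the largest possible negative covariance across an edge with label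
  \<open>m\<close>. The hypothesis forces \<open>m \<le> 6\<close>, where a factor below
  \<open>1 / 4\<close> in front of the cosine suffices.\<close>

lemma cos_pi_div_bound:
  assumes "2 \<le> m" "(cos (pi / real m))\<^sup>2 \<le> 3 / 4"
  shows "1 / 4 - 1 / (2 * real m) \<le> cos (pi / real m) / 5"
proof -
  have "\<not> 7 \<le> m"
  proof
    assume m: "7 \<le> m"
    have "pi / real m < pi / 6" using m by (simp add: field_simps)
    then have "cos (pi / 6) < cos (pi / real m)"
      using m by (intro cos_monotone_0_pi) (auto simp: field_simps)
    then have "(sqrt 3 / 2)\<^sup>2 < (cos (pi / real m))\<^sup>2"
      by (intro power_strict_mono) (auto simp: cos_30)
    then show False using assms(2) by (simp add: power_divide)
  qed
  then have "m \<in> {2, 3, 4, 5, 6}" using assms(1) by auto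
  \<comment> \<open>The numbers \<open>5 / 6\<close>, \<open>5 / 8\<close> and \<open>3 / 4\<close>
    are five times the left side at \<open>m = 6\<close>, 4 and 5.\<close>
  moreover have "5 / 6 \<le> cos (pi / 6)"
    unfolding cos_30 using real_le_rsqrt[of "5 / 3" 3] by (simp add: power2_eq_square)
  moreover have "5 / 8 \<le> cos (pi / 4)"
    unfolding cos_45 using real_le_rsqrt[of "5 / 4" 2] by (simp add: power2_eq_square)
  moreover have "3 / 4 \<le> cos (pi / 5)"
  proof -
    have "sin (pi / 10) \<le> pi / 10" by (rule sin_x_le_x) simp
    moreover have "pi \<le> 35 / 10" by (rule order_trans[OF pi_approx(2)]) simp
    ultimately have "sin (pi / 10) \<le> 35 / 100" by linarith
    moreover have "0 \<le> sin (pi / 10)" by (intro sin_ge_zero) auto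
    ultimately have "(sin (pi / 10))\<^sup>2 \<le> (35 / 100)\<^sup>2" by (intro power_mono)
    then show ?thesis using cos_double_sin[of "pi / 10"] by (simp add: power2_eq_square)
  qed
  ultimately show ?thesis by (auto simp: cos_60)
qed

context simple_roots
begin

text \<open>Closed neighbourhood in the Coxeter diagram; a root is never orthogonal to
  itself.\<close>

definition nb :: "vec \<Rightarrow> vec set" where "nb \<beta> = {\<gamma>\<in>\<Delta>. ip d \<beta> \<gamma> \<noteq> 0}"

lemma nb_subset: "nb \<beta> \<subseteq> \<Delta>" by (auto simp: nb_def)

lemma nb_self: "\<beta> \<in> \<Delta> \<Longrightarrow> \<beta> \<in> nb \<beta>"
  using root_ip_nonzero simple_root by (auto simp: nb_def)

lemma nb_sym: "\<beta> \<in> \<Delta> \<Longrightarrow> \<gamma> \<in> nb \<beta> \<Longrightarrow> \<beta> \<in> nb \<gamma>"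
  by (auto simp: nb_def ip_commute)

lemma finite_nb: "finite (nb \<beta>)"
  using finite_simple by (simp add: nb_def)

text \<open>The double sum is the squared length of the combination of unit vectors with weights
  \<open>a\<close>.\<close>

lemma gram_nonneg:
  assumes "S \<subseteq> \<Delta>"
  shows "0 \<le> (\<Sum>\<beta>\<in>S. \<Sum>\<gamma>\<in>S. a \<beta> * a \<gamma> * ip d (unit \<beta>) (unit \<gamma>))"
proof -
  let ?x = "\<lambda>i. \<Sum>\<beta>\<in>S. a \<beta> * unit \<beta> i"
  have "ip d ?x ?x = (\<Sum>\<beta>\<in>S. a \<beta> * ip d (unit \<beta>) ?x)" by (rule ip_sum_left)
  also have "\<dots> = (\<Sum>\<beta>\<in>S. a \<beta> * (\<Sum>\<gamma>\<in>S. a \<gamma> * ip d (unit \<gamma>) (unit \<beta>)))"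
    unfolding ip_commute[of d _ ?x] ip_sum_left ..
  also have "\<dots> = (\<Sum>\<beta>\<in>S. \<Sum>\<gamma>\<in>S. a \<beta> * a \<gamma> * ip d (unit \<beta>) (unit \<gamma>))"
    by (simp add: sum_distrib_left mult.assoc ip_commute)
  finally show ?thesis using ip_nonneg[of d ?x] by simp
qed

text \<open>The weights are 1 at \<open>\<beta>\<close> and \<open>cosang \<beta> \<gamma>\<close>
  on \<open>T\<close>. With \<open>q\<close> the sum in question, the row and column of
  \<open>\<beta>\<close> contribute \<open>1 - 2 * q\<close>, the diagonal over \<open>T\<close>
  contributes \<open>q\<close>, and the other entries are nonpositive, so
  \<open>0 \<le> 1 - q\<close>.\<close>

lemma cosang_star:
  assumes \<beta>: "\<beta> \<in> \<Delta>" and T: "T \<subseteq> \<Delta> - {\<beta>}"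
  shows "(\<Sum>\<gamma>\<in>T. (cosang \<beta> \<gamma>)\<^sup>2) \<le> 1"
proof -
  have fin: "finite T" using T finite_simple finite_subset by blast
  have bT: "\<beta> \<notin> T" using T by auto
  define a where "a \<gamma> = (if \<gamma> = \<beta> then 1 else cosang \<beta> \<gamma>)" for \<gamma>
  let ?g = "\<lambda>\<gamma> \<delta>. a \<gamma> * a \<delta> * ip d (unit \<gamma>) (unit \<delta>)"
  let ?q = "\<Sum>\<gamma>\<in>T. (cosang \<beta> \<gamma>)\<^sup>2"
  have aT: "a \<gamma> = cosang \<beta> \<gamma>" if "\<gamma> \<in> T" for \<gamma> using that bT by (auto simp: a_def)
  have "?g \<beta> \<beta> = 1" using ip_unit_self[OF simple_root[OF \<beta>]] by (simp add: a_def)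
  moreover have "(\<Sum>\<gamma>\<in>T. ?g \<beta> \<gamma>) = - ?q"
    using aT by (simp add: a_def[of \<beta>] cosang_def power2_eq_square sum_negf)
  moreover have "(\<Sum>\<gamma>\<in>T. ?g \<gamma> \<beta>) = - ?q"
    using aT by (simp add: a_def[of \<beta>] cosang_def power2_eq_square sum_negf ip_commute)
  moreover have "(\<Sum>\<gamma>\<in>T. \<Sum>\<delta>\<in>T. ?g \<gamma> \<delta>) \<le> ?q"
  proof (rule sum_mono)
    fix \<gamma> assume g: "\<gamma> \<in> T"
    have "(\<Sum>\<delta>\<in>T - {\<gamma>}. ?g \<gamma> \<delta>) \<le> 0"
    proof (rule sum_nonpos)
      fix \<delta> assume d: "\<delta> \<in> T - {\<gamma>}"
      have "a \<gamma> \<ge> 0" "a \<delta> \<ge> 0" "ip d (unit \<gamma>) (unit \<delta>) \<le> 0"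
        using g d T \<beta> aT cosang_nonneg[of \<beta> \<gamma>] cosang_nonneg[of \<beta> \<delta>] cosang_nonneg[of \<gamma> \<delta>]
        by (auto simp: cosang_def)
      then show "?g \<gamma> \<delta> \<le> 0" by (intro mult_nonneg_nonpos mult_nonneg_nonneg)
    qed
    moreover have "?g \<gamma> \<gamma> = (cosang \<beta> \<gamma>)\<^sup>2"
      using ip_unit_self[of \<gamma>] g T aT simple_root by (auto simp: power2_eq_square)
    ultimately show "(\<Sum>\<delta>\<in>T. ?g \<gamma> \<delta>) \<le> (cosang \<beta> \<gamma>)\<^sup>2"
      by (subst sum.remove[OF fin g]) simp
  qed
  moreover have "0 \<le> (\<Sum>\<gamma>\<in>insert \<beta> T. \<Sum>\<delta>\<in>insert \<beta> T. ?g \<gamma> \<delta>)"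
    using \<beta> T by (intro gram_nonneg) auto
  ultimately show ?thesis
    using fin bT by (simp add: sum.distrib)
qed

text \<open>Label 2 means orthogonality, so a neighbour has label at least 3, and
  \<open>cos (pi / 3) = 1 / 2\<close>.\<close>

lemma cosang_ge_half:
  assumes "\<beta> \<in> \<Delta>" "\<gamma> \<in> nb \<beta>" "\<gamma> \<noteq> \<beta>"
  shows "cosang \<beta> \<gamma> \<ge> 1 / 2"
proof -
  have g: "\<gamma> \<in> \<Delta>" using assms(2) by (simp add: nb_def)
  obtain m where m: "m \<ge> 2" "cosang \<beta> \<gamma> = cos (pi / real m)"
    using rank_two[OF assms(1) g] assms(3) by auto
  have "cosang \<beta> \<gamma> \<noteq> 0"
    using cosang_eq_0_iff[OF simple_root[OF assms(1)] simple_root[OF g]] assms(2) by (simp add: nb_def)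
  then have "m \<noteq> 2" using m(2) by auto
  then have m3: "m \<ge> 3" using m(1) by simp
  then have "pi / real m \<le> pi / 3" by (simp add: field_simps)
  then have "cos (pi / 3) \<le> cos (pi / real m)"
    using m3 by (intro cos_monotone_0_pi_le) (auto simp: field_simps)
  then show ?thesis using m(2) by (simp add: cos_60)
qed

text \<open>A second neighbour uses up at least \<open>1 / 4\<close> of the total 1 allowed at
  \<open>\<beta>\<close>. The remaining \<open>3 / 4\<close> is the square of
  \<open>cos (pi / 6)\<close>.\<close>

lemma cosang_two_neighbours:
  assumes "\<beta> \<in> \<Delta>" "\<gamma> \<in> nb \<beta>" "\<delta> \<in> nb \<beta>" "\<gamma> \<noteq> \<beta>" "\<delta> \<noteq> \<beta>" "\<gamma> \<noteq> \<delta>"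
  shows "(cosang \<beta> \<gamma>)\<^sup>2 \<le> 3 / 4"
proof -
  have "(\<Sum>x\<in>{\<gamma>, \<delta>}. (cosang \<beta> x)\<^sup>2) \<le> 1"
    by (rule cosang_star[OF assms(1)]) (use assms in \<open>auto simp: nb_def\<close>)
  moreover have "(1 / 2)\<^sup>2 \<le> (cosang \<beta> \<delta>)\<^sup>2"
    using cosang_ge_half[OF assms(1,3,5)] by (intro power_mono) auto
  ultimately show ?thesis using assms(6) by (simp add: power2_eq_square)
qed

text \<open>Each proper neighbour costs at least \<open>1 / 4\<close>, so there are at most four;
  \<open>\<beta>\<close> itself is the fifth.\<close>

lemma card_nb:
  assumes "\<beta> \<in> \<Delta>" shows "card (nb \<beta>) \<le> 5"
proof -
  have "real (card (nb \<beta> - {\<beta>})) * (1 / 2)\<^sup>2 = (\<Sum>\<gamma>\<in>nb \<beta> - {\<beta>}. (1 / 2)\<^sup>2)" by simp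
  also have "\<dots> \<le> (\<Sum>\<gamma>\<in>nb \<beta> - {\<beta>}. (cosang \<beta> \<gamma>)\<^sup>2)"
    using cosang_ge_half[OF assms] by (intro sum_mono power_mono) auto
  also have "\<dots> \<le> 1" using nb_subset by (intro cosang_star assms) auto
  finally have "card (nb \<beta> - {\<beta>}) \<le> 4" by (simp add: power2_eq_square)
  then show ?thesis using nb_self[OF assms] finite_nb[of \<beta>] by (simp add: card_Diff_singleton)
qed

section \<open>Isolated edges: the dihedral components of the diagram\<close>

definition isolated_edge :: "vec \<Rightarrow> vec \<Rightarrow> bool" where
  "isolated_edge \<beta> \<gamma> \<longleftrightarrow> \<beta> \<noteq> \<gamma> \<and> nb \<beta> = {\<beta>, \<gamma>} \<and> nb \<gamma> = {\<beta>, \<gamma>}"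

definition isolated :: "vec \<Rightarrow> bool" where
  "isolated \<beta> \<longleftrightarrow> (\<exists>\<gamma>. isolated_edge \<beta> \<gamma>)"

text \<open>The default \<open>\<beta>\<close> off the isolated edges makes this an involution of
  all of \<open>\<Delta>\<close>.\<close>

definition partner :: "vec \<Rightarrow> vec" where
  "partner \<beta> = (if isolated \<beta> then SOME \<gamma>. isolated_edge \<beta> \<gamma> else \<beta>)"

lemma isolated_edge_sym: "isolated_edge \<beta> \<gamma> \<Longrightarrow> isolated_edge \<gamma> \<beta>"
  by (auto simp: isolated_edge_def)

lemma isolated_edge_unique: "isolated_edge \<beta> \<gamma> \<Longrightarrow> isolated_edge \<beta> \<gamma>' \<Longrightarrow> \<gamma> = \<gamma>'"
  by (auto simp: isolated_edge_def doubleton_eq_iff)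

lemma isolated_edge_partner: "isolated \<beta> \<Longrightarrow> isolated_edge \<beta> (partner \<beta>)"
  by (simp add: partner_def isolated_def someI_ex[of "isolated_edge \<beta>"])

lemma partner_eq: "isolated_edge \<beta> \<gamma> \<Longrightarrow> partner \<beta> = \<gamma>"
  using isolated_edge_partner isolated_edge_unique isolated_def by blast

lemma isolated_partner: "isolated (partner \<beta>) \<longleftrightarrow> isolated \<beta>"
proof (cases "isolated \<beta>")
  case True
  then show ?thesis using isolated_edge_partner isolated_edge_sym isolated_def by blast
qed (simp add: partner_def)

lemma partner_partner: "partner (partner \<beta>) = \<beta>"
proof (cases "isolated \<beta>")
  case True
  then show ?thesis using isolated_edge_partner isolated_edge_sym partner_eq by blast
qed (simp add: partner_def)

text \<open>Thus merging the two ends of an isolated edge leaves the dependency graph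
  unchanged.\<close>

lemma nb_partner: "nb (partner \<beta>) = nb \<beta>"
proof (cases "isolated \<beta>")
  case True
  then show ?thesis using isolated_edge_partner unfolding isolated_edge_def by metis
qed (simp add: partner_def)

lemma nb_isolated: "isolated \<beta> \<Longrightarrow> nb \<beta> = {\<beta>, partner \<beta>}"
  using isolated_edge_partner unfolding isolated_edge_def by blast

lemma partner_simple: "\<beta> \<in> \<Delta> \<Longrightarrow> partner \<beta> \<in> \<Delta>"
  using nb_isolated nb_subset by (cases "isolated \<beta>") (auto simp: partner_def)

lemma isolated_nb: "\<beta> \<in> \<Delta> \<Longrightarrow> \<gamma> \<in> nb \<beta> \<Longrightarrow> isolated \<gamma> \<longleftrightarrow> isolated \<beta>"
proof -
  have *: "isolated \<gamma>" if "isolated \<beta>" "\<gamma> \<in> nb \<beta>" for \<beta> \<gamma>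
    using that nb_isolated[OF that(1)] isolated_partner by auto
  show "\<beta> \<in> \<Delta> \<Longrightarrow> \<gamma> \<in> nb \<beta> \<Longrightarrow> isolated \<gamma> \<longleftrightarrow> isolated \<beta>"
    using *[of \<beta> \<gamma>] *[of \<gamma> \<beta>] nb_sym by blast
qed

lemma bij_partner: "bij_betw partner \<Delta> \<Delta>"
  by (rule bij_betwI[where g = partner]) (auto simp: partner_simple partner_partner)

text \<open>The descent indicator minus its mean \<open>1 / 2\<close>.\<close>

definition descent_sign :: "vec \<Rightarrow> (vec \<Rightarrow> vec) \<Rightarrow> real" where
  "descent_sign \<beta> w = (if pos (w \<beta>) then -1 / 2 else 1 / 2)"

text \<open>On an isolated edge each of the two endpoints carries half of the merged variable, so that the
  index set remains \<open>\<Delta>\<close>.\<close>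

definition Y :: "vec \<Rightarrow> (vec \<Rightarrow> vec) \<Rightarrow> real" where
  "Y \<beta> w = (descent_sign \<beta> w + descent_sign (partner \<beta>) w) / 2"

definition v :: "vec \<Rightarrow> real" where "v \<beta> = mean (\<lambda>w. (Y \<beta> w)\<^sup>2)"

lemma num_descents_eq:
  assumes "w \<in> W"
  shows "real (num_descents \<Phi> \<Delta> w) = (\<Sum>\<beta>\<in>\<Delta>. descent_sign \<beta> w) + card \<Delta> / 2"
proof -
  have "num_descents \<Phi> \<Delta> w = card {\<beta>\<in>\<Delta>. \<not> pos (w \<beta>)}"
    unfolding num_descents_def using neg_roots_iff W_root[OF assms] simple_root
    by (intro arg_cong[where f = card]) auto
  also have "real \<dots> = (\<Sum>\<beta>\<in>\<Delta>. of_bool (\<not> pos (w \<beta>)))"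
    using finite_simple by (simp add: Int_def)
  also have "\<dots> = (\<Sum>\<beta>\<in>\<Delta>. descent_sign \<beta> w + 1 / 2)"
    by (intro sum.cong HOL.refl) (simp add: descent_sign_def)
  also have "\<dots> = (\<Sum>\<beta>\<in>\<Delta>. descent_sign \<beta> w) + card \<Delta> / 2" by (simp add: sum.distrib)
  finally show ?thesis .
qed

lemma sum_Y: "(\<Sum>\<beta>\<in>\<Delta>. Y \<beta> w) = (\<Sum>\<beta>\<in>\<Delta>. descent_sign \<beta> w)"
  using sum.reindex_bij_betw[OF bij_partner, of "\<lambda>\<beta>. descent_sign \<beta> w"]
  by (simp add: Y_def sum.distrib flip: sum_divide_distrib)

text \<open>Right multiplication by the reflection in \<open>\<beta>\<close> preserves the uniform
  distribution and flips the sign.\<close>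

lemma mean_descent_sign:
  assumes "\<beta> \<in> \<Delta>" shows "mean (descent_sign \<beta>) = 0"
proof -
  have b: "\<beta> \<in> \<Phi>" using simple_root[OF assms] .
  have "mean (descent_sign \<beta>) = mean (\<lambda>w. descent_sign \<beta> (w \<circ> refl d \<beta>))"
    by (rule mean_shift[OF coxeter_group_refl[OF b], symmetric])
  also have "\<dots> = mean (\<lambda>w. - descent_sign \<beta> w)"
  proof (rule mean_cong)
    fix w assume w: "w \<in> W"
    have "w (refl d \<beta> \<beta>) = (\<lambda>i. - w \<beta> i)"
      by (simp add: refl_self root_ip_nonzero[OF b] linear_fun_minus[OF coxeter_group_linear[OF w]])
    then show "descent_sign \<beta> (w \<circ> refl d \<beta>) = - descent_sign \<beta> w"
      using pos_uminus_root[OF W_root[OF w b]] by (simp add: descent_sign_def)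
  qed
  finally show ?thesis by simp
qed

lemma mean_Y: "\<beta> \<in> \<Delta> \<Longrightarrow> mean (Y \<beta>) = 0"
  by (simp add: Y_def[abs_def] Bochner_Integration.integral_add[OF integrable_W integrable_W]
      mean_descent_sign partner_simple)

lemma mean_descent_sign_mult:
  "mean (\<lambda>w. descent_sign \<beta> w * descent_sign \<gamma> w) = agree \<beta> \<gamma> / 2 - 1 / 4"
proof -
  have "mean (\<lambda>w. descent_sign \<beta> w * descent_sign \<gamma> w) = mean (\<lambda>w. of_bool (pos (w \<beta>) = pos (w \<gamma>)) / 2 - 1 / 4)"
    by (intro mean_cong) (simp add: descent_sign_def)
  then show ?thesis
    by (simp add: agree_def Bochner_Integration.integral_diff[OF integrable_W integrable_W])
qed

lemma Y_not_isolated: "\<not> isolated \<beta> \<Longrightarrow> Y \<beta> w = descent_sign \<beta> w"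
  by (simp add: Y_def partner_def)

lemma Y_isolated_nb:
  assumes "isolated \<beta>" "\<gamma> \<in> nb \<beta>" shows "Y \<gamma> w = Y \<beta> w"
  using assms(2) nb_isolated[OF assms(1)] by (auto simp: Y_def partner_partner)

text \<open>On an isolated edge both ends carry the same variable; elsewhere the absolute value is
  always \<open>1 / 2\<close>. So the second moment \<open>v\<close> dominates the mixed
  moments.\<close>

lemma abs_Y_mult:
  assumes "\<beta> \<in> \<Delta>" "\<gamma> \<in> nb \<beta>" shows "\<bar>Y \<beta> w * Y \<gamma> w\<bar> = (Y \<beta> w)\<^sup>2"
proof (cases "isolated \<beta>")
  case True
  then show ?thesis using Y_isolated_nb[OF True assms(2)] by (simp add: power2_eq_square)
next
  case False
  then have "\<not> isolated \<gamma>" using isolated_nb[OF assms] by simp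
  with False show ?thesis by (simp add: Y_not_isolated descent_sign_def power2_eq_square)
qed

text \<open>A merged variable reads the signs at both ends of its edge, so the set must be closed
  under partners.\<close>

lemma determined_on_imp_descent_determined:
  assumes "determined_on (pmf_of_set W) Y A f"
  shows "descent_determined (A \<union> partner ` A) f"
  unfolding descent_determined_def
proof (intro ballI impI)
  fix w w' assume w: "w \<in> W" "w' \<in> W" and *: "\<forall>\<beta>\<in>A \<union> partner ` A. pos (w \<beta>) = pos (w' \<beta>)"
  have "\<forall>\<beta>\<in>A. Y \<beta> w = Y \<beta> w'" using * by (simp add: Y_def descent_sign_def)
  then show "f w = f w'"
    using assms w unfolding determined_on_def set_pmf_of_set[OF W_nonempty finite_W] by blast
qed

lemma descent_dependency_graph: "dependency_graph (pmf_of_set W) \<Delta> nb 5 Y v"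
proof
  show "finite (set_pmf (pmf_of_set W))" by (simp add: finite_W W_nonempty)
  show "finite \<Delta>" by (rule finite_simple)
  show "nb \<beta> \<subseteq> \<Delta>" for \<beta> by (rule nb_subset)
  show "\<beta> \<in> nb \<beta>" if "\<beta> \<in> \<Delta>" for \<beta> using that by (rule nb_self)
  show "\<beta> \<in> nb \<gamma>" if "\<beta> \<in> \<Delta>" "\<gamma> \<in> nb \<beta>" for \<beta> \<gamma> using that by (rule nb_sym)
  show "card (nb \<beta>) \<le> 5" if "\<beta> \<in> \<Delta>" for \<beta> using that by (rule card_nb)
  show "\<bar>Y \<beta> w\<bar> \<le> 1" for \<beta> w by (simp add: Y_def descent_sign_def)
  show "mean (Y \<beta>) = 0" if "\<beta> \<in> \<Delta>" for \<beta> using that by (rule mean_Y)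
  show "mean (\<lambda>w. \<bar>Y \<beta> w * Y \<gamma> w\<bar>) \<le> v \<beta>" if "\<beta> \<in> \<Delta>" "\<gamma> \<in> nb \<beta>" for \<beta> \<gamma>
    unfolding v_def abs_Y_mult[OF that] ..
  fix A B and f g :: "(vec \<Rightarrow> vec) \<Rightarrow> complex"
  assume A: "A \<subseteq> \<Delta>" and B: "B \<subseteq> \<Delta>" and AB: "\<And>a b. a \<in> A \<Longrightarrow> b \<in> B \<Longrightarrow> b \<notin> nb a"
    and f: "determined_on (pmf_of_set W) Y A f" and g: "determined_on (pmf_of_set W) Y B g"
  show "mean (\<lambda>w. f w * g w) = mean f * mean g"
  proof (rule mean_mult_orthogonal)
    show "descent_determined (A \<union> partner ` A) f" "descent_determined (B \<union> partner ` B) g"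
      by (rule determined_on_imp_descent_determined, rule f, rule determined_on_imp_descent_determined, rule g)
    show sub: "A \<union> partner ` A \<subseteq> \<Delta>" "B \<union> partner ` B \<subseteq> \<Delta>"
      using A B partner_simple by auto
    fix \<beta> \<gamma> assume bg: "\<beta> \<in> A \<union> partner ` A" "\<gamma> \<in> B \<union> partner ` B"
    \<comment> \<open>Adding partners creates no new adjacency, since partners share their closed
      neighbourhood.\<close>
    have "\<exists>a\<in>A. nb \<beta> = nb a" "\<exists>b\<in>B. nb \<gamma> = nb b" using bg nb_partner by auto
    then obtain a b where ab: "a \<in> A" "nb \<beta> = nb a" "b \<in> B" "nb \<gamma> = nb b" by blast
    have abD: "a \<in> \<Delta>" "b \<in> \<Delta>" using ab(1,3) A B by auto
    show "ip d \<beta> \<gamma> = 0"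
    proof (rule ccontr)
      assume "ip d \<beta> \<gamma> \<noteq> 0"
      then have "\<gamma> \<in> nb a" using bg(2) sub ab(2) by (auto simp: nb_def)
      then have "a \<in> nb b" using nb_sym[OF abD(1)] ab(4) by auto
      then have "b \<in> nb a" using nb_sym[OF abD(2)] by blast
      then show False using AB ab by blast
    qed
  qed
qed

text \<open>As the edge is not isolated, one of its ends has a second neighbour, which limits the
  cosine and hence the label; \<open>rank_two\<close> then bounds the covariance.\<close>

lemma covariance_bound:
  assumes "\<beta> \<in> \<Delta>" "\<not> isolated \<beta>" "\<gamma> \<in> nb \<beta>" "\<gamma> \<noteq> \<beta>"
  shows "mean (\<lambda>w. descent_sign \<beta> w * descent_sign \<gamma> w) \<ge> - cosang \<beta> \<gamma> / 5"
proof -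
  have g: "\<gamma> \<in> \<Delta>" "\<beta> \<in> nb \<gamma>" using assms(1,3) nb_subset nb_sym by auto
  obtain m where m: "m \<ge> 2" "cosang \<beta> \<gamma> = cos (pi / real m)" "1 \<le> real m * agree \<beta> \<gamma>"
    using rank_two[OF assms(1) g(1)] assms(4) by auto
  have "\<not> (nb \<beta> = {\<beta>, \<gamma>} \<and> nb \<gamma> = {\<beta>, \<gamma>})"
    using assms(2) assms(4)[symmetric] unfolding isolated_def isolated_edge_def by metis
  then have "(\<exists>\<delta>\<in>nb \<beta>. \<delta> \<noteq> \<beta> \<and> \<delta> \<noteq> \<gamma>) \<or> (\<exists>\<delta>\<in>nb \<gamma>. \<delta> \<noteq> \<beta> \<and> \<delta> \<noteq> \<gamma>)"
    using nb_self assms(1,3) g by blast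
  then have "(cosang \<beta> \<gamma>)\<^sup>2 \<le> 3 / 4"
    using cosang_two_neighbours[OF assms(1,3)] cosang_two_neighbours[OF g] assms(4)
    by (auto simp: cosang_commute)
  then have "1 / 4 - 1 / (2 * real m) \<le> cosang \<beta> \<gamma> / 5"
    using cos_pi_div_bound[OF m(1)] m(2) by simp
  moreover have "agree \<beta> \<gamma> \<ge> 1 / real m" using m(1,3) by (simp add: field_simps)
  ultimately show ?thesis unfolding mean_descent_sign_mult by simp
qed

text \<open>The diagram splits into the isolated edges \<open>P\<close> and the rest
  \<open>Q\<close>. On \<open>P\<close> the merged variables have no negative covariance; on
  \<open>Q\<close> the all-ones Gram inequality pays for it.\<close>

lemma sum_v_le:
  "(\<Sum>\<beta>\<in>\<Delta>. v \<beta>) \<le> 5 * mean (\<lambda>w. (\<Sum>\<beta>\<in>\<Delta>. Y \<beta> w)\<^sup>2)"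
proof -
  interpret G: dependency_graph "pmf_of_set W" \<Delta> nb 5 Y v by (rule descent_dependency_graph)
  define P where "P = {\<beta>\<in>\<Delta>. isolated \<beta>}"
  define Q where "Q = {\<beta>\<in>\<Delta>. \<not> isolated \<beta>}"
  have PQ: "\<Delta> = P \<union> Q" "P \<inter> Q = {}" "finite P" "finite Q" "Q \<subseteq> \<Delta>"
    using finite_simple by (auto simp: P_def Q_def)
  let ?s = "\<lambda>\<beta>. \<Sum>\<gamma>\<in>nb \<beta>. mean (\<lambda>w. Y \<beta> w * Y \<gamma> w)"
  have s: "mean (\<lambda>w. (\<Sum>\<beta>\<in>\<Delta>. Y \<beta> w)\<^sup>2) = (\<Sum>\<beta>\<in>P. ?s \<beta>) + (\<Sum>\<beta>\<in>Q. ?s \<beta>)"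
    unfolding G.second_moment_sum by (subst PQ(1)) (rule sum.union_disjoint[OF PQ(3,4,2)])
  have v_nonneg: "v \<beta> \<ge> 0" for \<beta> by (simp add: v_def integral_nonneg_AE)
  have P: "v \<beta> \<le> ?s \<beta>" if "\<beta> \<in> P" for \<beta>
  proof -
    have b: "\<beta> \<in> \<Delta>" "isolated \<beta>" using that by (auto simp: P_def)
    have "?s \<beta> = (\<Sum>\<gamma>\<in>nb \<beta>. v \<beta>)"
      by (intro sum.cong HOL.refl) (simp add: v_def Y_isolated_nb[OF b(2)] power2_eq_square)
    also have "\<dots> \<ge> v \<beta>"
      using nb_self[OF b(1)] finite_nb v_nonneg by (intro member_le_sum) auto
    finally show ?thesis .
  qed
  have vQ: "v \<beta> = 1 / 4" if "\<beta> \<in> Q" for \<beta>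
  proof -
    have "v \<beta> = mean (\<lambda>w. 1 / 4)"
      unfolding v_def using that
      by (intro mean_cong) (simp add: Q_def Y_not_isolated descent_sign_def power2_eq_square)
    then show ?thesis by simp
  qed
  have Q: "1 / 4 - (\<Sum>\<gamma>\<in>Q - {\<beta>}. cosang \<beta> \<gamma>) / 5 \<le> ?s \<beta>" if "\<beta> \<in> Q" for \<beta>
  proof -
    have b: "\<beta> \<in> \<Delta>" "\<not> isolated \<beta>" using that by (auto simp: Q_def)
    have sub: "nb \<beta> - {\<beta>} \<subseteq> Q - {\<beta>}"
      using isolated_nb[OF b(1)] b(2) nb_subset by (auto simp: Q_def)
    \<comment> \<open>Non-neighbours contribute cosine 0; the sum over all of \<open>Q\<close> has
      the shape of a row of the Gram matrix.\<close>
    have "(\<Sum>\<gamma>\<in>Q - {\<beta>}. cosang \<beta> \<gamma>) = (\<Sum>\<gamma>\<in>nb \<beta> - {\<beta>}. cosang \<beta> \<gamma>)"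
    proof (rule sum.mono_neutral_right[OF _ sub])
      show "\<forall>\<gamma>\<in>Q - {\<beta>} - (nb \<beta> - {\<beta>}). cosang \<beta> \<gamma> = 0"
        using PQ(5) b(1) simple_root cosang_eq_0_iff by (auto simp: nb_def)
    qed (use PQ in simp)
    then have "- (\<Sum>\<gamma>\<in>Q - {\<beta>}. cosang \<beta> \<gamma>) / 5 = (\<Sum>\<gamma>\<in>nb \<beta> - {\<beta>}. - cosang \<beta> \<gamma> / 5)"
      by (simp add: sum_negf sum_divide_distrib)
    also have "\<dots> \<le> (\<Sum>\<gamma>\<in>nb \<beta> - {\<beta>}. mean (\<lambda>w. Y \<beta> w * Y \<gamma> w))"
    proof (rule sum_mono)
      fix \<gamma> assume g: "\<gamma> \<in> nb \<beta> - {\<beta>}"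
      then have "\<not> isolated \<gamma>" using isolated_nb[OF b(1)] b(2) by blast
      then show "- cosang \<beta> \<gamma> / 5 \<le> mean (\<lambda>w. Y \<beta> w * Y \<gamma> w)"
        using covariance_bound[OF b] g b(2) by (simp add: Y_not_isolated)
    qed
    finally have "- (\<Sum>\<gamma>\<in>Q - {\<beta>}. cosang \<beta> \<gamma>) / 5
        \<le> (\<Sum>\<gamma>\<in>nb \<beta> - {\<beta>}. mean (\<lambda>w. Y \<beta> w * Y \<gamma> w))" .
    moreover have "?s \<beta> = v \<beta> + (\<Sum>\<gamma>\<in>nb \<beta> - {\<beta>}. mean (\<lambda>w. Y \<beta> w * Y \<gamma> w))"
      by (subst sum.remove[OF finite_nb nb_self[OF b(1)]]) (simp add: v_def power2_eq_square)
    ultimately show ?thesis using vQ[OF that] by simp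
  qed
  have "0 \<le> (\<Sum>\<beta>\<in>Q. \<Sum>\<gamma>\<in>Q. 1 * 1 * ip d (unit \<beta>) (unit \<gamma>))"
    by (rule gram_nonneg[OF PQ(5), of "\<lambda>_. 1"])
  also have "\<dots> = (\<Sum>\<beta>\<in>Q. 1 - (\<Sum>\<gamma>\<in>Q - {\<beta>}. cosang \<beta> \<gamma>))"
  proof (rule sum.cong[OF HOL.refl])
    fix \<beta> assume b: "\<beta> \<in> Q"
    then have "ip d (unit \<beta>) (unit \<beta>) = 1" using PQ(5) simple_root by (intro ip_unit_self) auto
    then show "(\<Sum>\<gamma>\<in>Q. 1 * 1 * ip d (unit \<beta>) (unit \<gamma>)) = 1 - (\<Sum>\<gamma>\<in>Q - {\<beta>}. cosang \<beta> \<gamma>)"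
      by (subst sum.remove[OF PQ(4) b]) (simp add: cosang_def sum_negf)
  qed
  finally have "0 \<le> (\<Sum>\<beta>\<in>Q. 1 - (\<Sum>\<gamma>\<in>Q - {\<beta>}. cosang \<beta> \<gamma>))" .
  then have "(\<Sum>\<beta>\<in>Q. v \<beta>) \<le> (\<Sum>\<beta>\<in>Q. v \<beta>) + (\<Sum>\<beta>\<in>Q. 1 - (\<Sum>\<gamma>\<in>Q - {\<beta>}. cosang \<beta> \<gamma>))"
    by simp
  \<comment> \<open>With \<open>S\<close> the cosine sum at a vertex,
    \<open>1 / 4 + (1 - S) = 5 * (1 / 4 - S / 5)\<close>; this is where the factor 5 comes
    from.\<close>
  also have "\<dots> = (\<Sum>\<beta>\<in>Q. 5 * (1 / 4 - (\<Sum>\<gamma>\<in>Q - {\<beta>}. cosang \<beta> \<gamma>) / 5))"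
    unfolding sum.distrib[symmetric] by (intro sum.cong HOL.refl) (simp add: vQ)
  also have "\<dots> \<le> (\<Sum>\<beta>\<in>Q. 5 * ?s \<beta>)"
    using Q by (intro sum_mono mult_left_mono) auto
  finally have vQ_le: "(\<Sum>\<beta>\<in>Q. v \<beta>) \<le> 5 * (\<Sum>\<beta>\<in>Q. ?s \<beta>)" by (simp add: sum_distrib_left)
  have vP_le: "(\<Sum>\<beta>\<in>P. v \<beta>) \<le> 5 * (\<Sum>\<beta>\<in>P. ?s \<beta>)"
  proof -
    have "(\<Sum>\<beta>\<in>P. v \<beta>) \<le> (\<Sum>\<beta>\<in>P. ?s \<beta>)" using P by (rule sum_mono)
    moreover have "0 \<le> (\<Sum>\<beta>\<in>P. v \<beta>)" using v_nonneg by (intro sum_nonneg)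
    ultimately show ?thesis by linarith
  qed
  have "(\<Sum>\<beta>\<in>\<Delta>. v \<beta>) = (\<Sum>\<beta>\<in>P. v \<beta>) + (\<Sum>\<beta>\<in>Q. v \<beta>)"
    by (subst PQ(1)) (rule sum.union_disjoint[OF PQ(3,4,2)])
  then show ?thesis unfolding s distrib_left using add_mono[OF vP_le vQ_le] by (simp only:)
qed

lemma mean_num_descents: "mean (\<lambda>w. real (num_descents \<Phi> \<Delta> w)) = card \<Delta> / 2"
proof -
  have "mean (\<lambda>w. real (num_descents \<Phi> \<Delta> w)) = mean (\<lambda>w. (\<Sum>\<beta>\<in>\<Delta>. Y \<beta> w) + card \<Delta> / 2)"
    by (intro mean_cong) (simp add: num_descents_eq sum_Y)
  also have "\<dots> = card \<Delta> / 2"     by (simp add: Bochner_Integration.integral_add[OF integrable_W integrable_W]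
        Bochner_Integration.integral_sum[OF integrable_W] mean_Y)
  finally show ?thesis .
qed

text \<open>The constant 500 is \<open>4 * (real D)\<^sup>2 * K\<close> with \<open>D = 5\<close>
  from \<open>card_nb\<close> and \<open>K = 5\<close> from \<open>sum_v_le\<close>, uniform in the
  group and its rank.\<close>

theorem descents_char_estimate:
  fixes t :: real
  defines "X \<equiv> \<lambda>w. real (num_descents \<Phi> \<Delta> w)"
  defines "s \<equiv> sqrt (measure_pmf.variance (pmf_of_set W) X)"
  assumes s: "s > 0"
  shows "cmod (mean (\<lambda>w. iexp (t * ((X w - mean X) / s))) - exp (- t\<^sup>2 / 2)) \<le> 500 * \<bar>t\<bar> ^ 3 / s"
proof -
  interpret G: dependency_graph "pmf_of_set W" \<Delta> nb 5 Y v by (rule descent_dependency_graph)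
  have X: "X w - mean X = (\<Sum>\<beta>\<in>\<Delta>. Y \<beta> w)" if "w \<in> W" for w
    unfolding X_def mean_num_descents using num_descents_eq[OF that] by (simp add: sum_Y)
  have "measure_pmf.variance (pmf_of_set W) X = mean (\<lambda>w. (\<Sum>\<beta>\<in>\<Delta>. Y \<beta> w)\<^sup>2)"
    by (rule mean_cong) (simp add: X)
  then have var: "s\<^sup>2 = mean (\<lambda>w. (\<Sum>\<beta>\<in>\<Delta>. Y \<beta> w)\<^sup>2)"
    by (simp add: s_def integral_nonneg_AE)
  have "mean (\<lambda>w. iexp (t * ((X w - mean X) / s))) = mean (\<lambda>w. iexp (t * ((\<Sum>\<beta>\<in>\<Delta>. Y \<beta> w) / s)))"
    by (rule mean_cong) (simp only: X)
  then show ?thesis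
    using G.char_normal_estimate[OF s var, of 5 t] sum_v_le var by simp
qed

end

theorem theorem6p2:
  fixes d :: "nat \<Rightarrow> nat" and \<Phi> \<Delta> :: "nat \<Rightarrow> (nat \<Rightarrow> real) set"
  assumes "\<And>n. n \<ge> 1 \<Longrightarrow> root_system (d n) (\<Phi> n)"
      and "\<And>n. n \<ge> 1 \<Longrightarrow> simple_system (\<Phi> n) (\<Delta> n)"
      and "\<And>n. n \<ge> 1 \<Longrightarrow> card (\<Delta> n) = n"
  shows "satisfies_CLT (\<lambda>n. pmf_of_set (coxeter_group (d n) (\<Phi> n)))
           (\<lambda>n w. real (num_descents (\<Phi> n) (\<Delta> n) w))
         \<longleftrightarrow> filterlim (\<lambda>n. sqrt (measure_pmf.variance (pmf_of_set (coxeter_group (d n) (\<Phi> n)))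
                                   (\<lambda>w. real (num_descents (\<Phi> n) (\<Delta> n) w))))
               at_top sequentially"
proof
  assume "satisfies_CLT (\<lambda>n. pmf_of_set (coxeter_group (d n) (\<Phi> n)))
           (\<lambda>n w. real (num_descents (\<Phi> n) (\<Delta> n) w))"
  then show "filterlim (\<lambda>n. sqrt (measure_pmf.variance (pmf_of_set (coxeter_group (d n) (\<Phi> n)))
      (\<lambda>w. real (num_descents (\<Phi> n) (\<Delta> n) w)))) at_top sequentially"
    unfolding satisfies_CLT_def
    by (rule normal_limit_imp_scale_unbounded) (simp add: integral_nonneg_AE)
next
  assume s: "filterlim (\<lambda>n. sqrt (measure_pmf.variance (pmf_of_set (coxeter_group (d n) (\<Phi> n)))
      (\<lambda>w. real (num_descents (\<Phi> n) (\<Delta> n) w)))) at_top sequentially"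
  show "satisfies_CLT (\<lambda>n. pmf_of_set (coxeter_group (d n) (\<Phi> n)))
      (\<lambda>n w. real (num_descents (\<Phi> n) (\<Delta> n) w))"
    unfolding satisfies_CLT_def
  proof (rule normal_limit_of_char_estimate[OF _ s])
    fix n :: nat and t :: real
    \<comment> \<open>The root data at index 0 are arbitrary; the locale is available from
      \<open>n = 1\<close> on.\<close>
    assume n: "n \<ge> 1"
    interpret simple_roots "d n" "\<Phi> n" "\<Delta> n" using assms(1,2) n by unfold_locales
    show "0 < sqrt (measure_pmf.variance (pmf_of_set W) (\<lambda>w. real (num_descents (\<Phi> n) (\<Delta> n) w))) \<Longrightarrow>
      cmod (mean (\<lambda>w. iexp (t * ((real (num_descents (\<Phi> n) (\<Delta> n) w)
          - mean (\<lambda>w. real (num_descents (\<Phi> n) (\<Delta> n) w)))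
          / sqrt (measure_pmf.variance (pmf_of_set W) (\<lambda>w. real (num_descents (\<Phi> n) (\<Delta> n) w))))))
        - exp (- t\<^sup>2 / 2)) \<le> 500 * \<bar>t\<bar> ^ 3
        / sqrt (measure_pmf.variance (pmf_of_set W) (\<lambda>w. real (num_descents (\<Phi> n) (\<Delta> n) w)))"
      by (rule descents_char_estimate)
  qed
qed

end
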